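(* Let $\overline{\sigma}\ge\underline{\sigma}>0$ and let $G(a)=\frac12(\overline{\sigma}^2a^+-\underline{\sigma}^2a^-)$ for $a\in\mathbb{R}$. There exist $\alpha\in(0,1)$, depending only on $\underline{\sigma}$ and $\overline{\sigma}$, and a constant $C_{\alpha,G}>0$, depending only on $\alpha,\underline{\sigma},\overline{\sigma}$, such that the following holds. Let $(\Omega,\mathcal{H},\hat{\mathbf{E}})$ be a sublinear expectation space and let $(X_i)_{i\ge1}$ be a sequence of i.i.d. random variables in it with $\hat{\mathbf{E}}[X_1]=\hat{\mathbf{E}}[-X_1]=0$, $\hat{\mathbf{E}}[X_1^2]=\overline{\sigma}^2$ and $-\hat{\mathbf{E}}[-X_1^2]=\underline{\sigma}^2$ (so that $G(a)=\frac12\hat{\mathbf{E}}[aX_1^2]$). Then for every $n\ge 1$, with $W_n:=\frac{X_1+\cdots+X_n}{\sqrt n}$, $$\sup_{\varphi\in C_{b,Lip}(\mathbb{R}),\ |\varphi|_{Lip}\le 1}\Big|\hat{\mathbf{E}}[\varphi(W_n)]-\mathcal{N}_G[\varphi]\Big|\le C_{\alpha,G}\,\frac{\hat{\mathbf{E}}[|X_1|^{2+\alpha}]}{n^{\alpha/2}},$$ where $\mathcal{N}_G$ is the $G$-normal distribution.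
   Context: $C_{b,Lip}(\mathbb{R}^m)$ is the set of bounded Lipschitz functions on $\mathbb{R}^m$; $|\varphi|_{Lip}$ is the Lipschitz constant of $\varphi$; $a^+=\max(a,0)$, $a^-=\max(-a,0)$. Sublinear expectation space: $\Omega$ is a set, $\mathcal{H}$ is a linear space of real functions on $\Omega$ (the random variables) such that $\varphi(X_1,\dots,X_m)\in\mathcal{H}$ whenever $X_1,\dots,X_m\in\mathcal{H}$ and $\varphi\in C_{b,Lip}(\mathbb{R}^m)$, and $\hat{\mathbf{E}}:\mathcal{H}\to\mathbb{R}$ satisfies: (E1) $\hat{\mathbf{E}}[X]\ge\hat{\mathbf{E}}[Y]$ if $X\ge Y$; (E2) $\hat{\mathbf{E}}[\lambda X]=\lambda\hat{\mathbf{E}}[X]$ for $\lambda\ge0$; (E3) $\hat{\mathbf{E}}[c]=c$ for $c\in\mathbb{R}$; (E4) $\hat{\mathbf{E}}[X+Y]\le\hat{\mathbf{E}}[X]+\hat{\mathbf{E}}[Y]$; (E5) $\hat{\mathbf{E}}[\varphi_n(X)]\downarrow0$ for $X\in\mathcal{H}$ and $\varphi_n\in C_{b,Lip}(\mathbb{R})$ with $\varphi_n\downarrow0$. For each $X\in\mathcal{H}$ there is a weakly compact set $\Theta$ of probability measures on $(\mathbb{R},\mathcal{B}(\mathbb{R}))$ with $\hat{\mathbf{E}}[\varphi(X)]=\sup_{\mu\in\Theta}\int\varphi\,d\mu$ for all $\varphi\in C_{b,Lip}(\mathbb{R})$; expectations of unbounded functions of $X$ (such as $X$, $-X$, $\pm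 X^2$, $|X|^{2+\alpha}$) are understood as $\hat{\mathbf{E}}[\psi(X)]=\sup_{\mu\in\Theta}\int\psi\,d\mu$ (the value $+\infty$ being allowed for $\hat{\mathbf{E}}[|X_1|^{2+\alpha}]$). Independence: a random vector $\mathbf{X}\in\mathcal{H}^m$ is independent from $\mathbf{Y}\in\mathcal{H}^n$ if $\hat{\mathbf{E}}[\varphi(\mathbf{Y},\mathbf{X})]=\hat{\mathbf{E}}\big[\hat{\mathbf{E}}[\varphi(\mathbf{y},\mathbf{X})]|_{\mathbf{y}=\mathbf{Y}}\big]$ for all $\varphi\in C_{b,Lip}(\mathbb{R}^{n+m})$ (this relation is not symmetric). $X$ and $Y$ are identically distributed if $\hat{\mathbf{E}}[\varphi(X)]=\hat{\mathbf{E}}[\varphi(Y)]$ for all bounded Lipschitz $\varphi$. The sequence $(X_i)_{i\ge1}$ is i.i.d. if all $X_i$ are identically distributed and $X_{i+1}$ is independent from $(X_1,\dots,X_i)$ for every $i\ge1$. $G$-normal distribution: for $\varphi\in C_{b,Lip}(\mathbb{R})$, let $u$ be the unique bounded solution (viscosity, in fact classical since $\underline{\sigma}>0$) of the $G$-heat equation $\partial_tu-G(D_x^2u)=0$ on $\mathbb{R}\times(0,\infty)$, $u(x,0)=\varphi(x)$. Then $\mathcal{N}_G[\varphi]:=u(0,1)$; more generally $u(x,t)=\mathcal{N}_G[\varphi(x+\sqrt t\,\cdot)]$. *)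

theory Defs
  imports "HOL-Probability.Probability"
begin

section \<open>Bounded Lipschitz functions\<close>

definition CbLip :: "(real \<Rightarrow> real) set" where
  "CbLip = {\<phi>. bounded (range \<phi>) \<and> (\<exists>L. L-lipschitz_on UNIV \<phi>)}"

text \<open>
  Since the dimension varies, a point of Euclidean m-space is given by the first m values of a
  sequence.  The Lipschitz condition, with respect to the Euclidean distance of these m values,
  forces a member of \<open>CbLip_dim m\<close> to depend on them only.
\<close>

definition CbLip_dim :: "nat \<Rightarrow> ((nat \<Rightarrow> real) \<Rightarrow> real) set" where
  "CbLip_dim m = {\<phi>. bounded (range \<phi>) \<and>
     (\<exists>L. \<forall>x y. \<bar>\<phi> x - \<phi> y\<bar> \<le> L * L2_set (\<lambda>i. x i - y i) {..<m})}"


section \<open>Sublinear expectation spaces\<close>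

text \<open>
  The sample space is the type \<open>'w\<close>.  The values of \<open>E\<close> outside \<open>H\<close> are irrelevant.
\<close>

locale sublinear_expectation_space =
  fixes H :: "('w \<Rightarrow> real) set" and E :: "('w \<Rightarrow> real) \<Rightarrow> real"
  assumes zero_mem: "(\<lambda>_. 0) \<in> H"
    and add_mem: "X \<in> H \<Longrightarrow> Y \<in> H \<Longrightarrow> (\<lambda>w. X w + Y w) \<in> H"
    and scale_mem: "X \<in> H \<Longrightarrow> (\<lambda>w. c * X w) \<in> H"
    and comp_mem: "(\<And>i. i < m \<Longrightarrow> Z i \<in> H) \<Longrightarrow> \<psi> \<in> CbLip_dim m \<Longrightarrow>
                   (\<lambda>w. \<psi> (\<lambda>i. Z i w)) \<in> H"
    and E_mono: "X \<in> H \<Longrightarrow> Y \<in> H \<Longrightarrow> (\<And>w. Y w \<le> X w) \<Longrightarrow> E Y \<le> E X"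
    and E_scale: "X \<in> H \<Longrightarrow> 0 \<le> c \<Longrightarrow> E (\<lambda>w. c * X w) = c * E X"
    and E_const: "E (\<lambda>_. c) = c"
    and E_subadd: "X \<in> H \<Longrightarrow> Y \<in> H \<Longrightarrow> E (\<lambda>w. X w + Y w) \<le> E X + E Y"
    and E_cont: "X \<in> H \<Longrightarrow> (\<And>n. \<phi> n \<in> CbLip) \<Longrightarrow>
                 (\<And>x. decseq (\<lambda>n. \<phi> n x)) \<Longrightarrow> (\<And>x. (\<lambda>n. \<phi> n x) \<longlonglongrightarrow> 0) \<Longrightarrow>
                 decseq (\<lambda>n. E (\<lambda>w. \<phi> n (X w))) \<and> (\<lambda>n. E (\<lambda>w. \<phi> n (X w))) \<longlonglongrightarrow> 0"

definition identically_distributed ::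
  "(('w \<Rightarrow> real) \<Rightarrow> real) \<Rightarrow> ('w \<Rightarrow> real) \<Rightarrow> ('w \<Rightarrow> real) \<Rightarrow> bool" where
  "identically_distributed E X Y \<longleftrightarrow>
     (\<forall>\<phi>\<in>CbLip. E (\<lambda>w. \<phi> (X w)) = E (\<lambda>w. \<phi> (Y w)))"

definition join_vec :: "nat \<Rightarrow> (nat \<Rightarrow> real) \<Rightarrow> (nat \<Rightarrow> real) \<Rightarrow> nat \<Rightarrow> real" where
  "join_vec n y x = (\<lambda>i. if i < n then y i else x (i - n))"

text \<open>
  \<open>independent_from E m X n Y\<close>: the m-dimensional random vector with components
  \<open>X 0, \<dots>, X (m - 1)\<close> is independent from the n-dimensional one with components
  \<open>Y 0, \<dots>, Y (n - 1)\<close>.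
\<close>

definition independent_from ::
  "(('w \<Rightarrow> real) \<Rightarrow> real) \<Rightarrow> nat \<Rightarrow> (nat \<Rightarrow> 'w \<Rightarrow> real) \<Rightarrow> nat \<Rightarrow> (nat \<Rightarrow> 'w \<Rightarrow> real) \<Rightarrow> bool" where
  "independent_from E m X n Y \<longleftrightarrow>
     (\<forall>\<phi>\<in>CbLip_dim (n + m).
        E (\<lambda>w. \<phi> (join_vec n (\<lambda>i. Y i w) (\<lambda>i. X i w))) =
        E (\<lambda>w. E (\<lambda>w'. \<phi> (join_vec n (\<lambda>i. Y i w) (\<lambda>i. X i w')))))"

text \<open>Sequences of random variables start at index 1; \<open>X 0\<close> plays no role.\<close>

definition iid_sequence ::
  "('w \<Rightarrow> real) set \<Rightarrow> (('w \<Rightarrow> real) \<Rightarrow> real) \<Rightarrow> (nat \<Rightarrow> 'w \<Rightarrow> real) \<Rightarrow> bool" where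
  "iid_sequence H E X \<longleftrightarrow>
     (\<forall>i\<ge>1. X i \<in> H) \<and>
     (\<forall>i\<ge>1. \<forall>j\<ge>1. identically_distributed E (X i) (X j)) \<and>
     (\<forall>i\<ge>1. independent_from E 1 (\<lambda>_. X (i + 1)) i (\<lambda>j. X (j + 1)))"


section \<open>Expectations of unbounded functions of a random variable\<close>

definition weak_topology :: "real measure topology" where
  "weak_topology = topology_generated_by
     {{M. real_distribution M \<and> (LINT x|M. f x) \<in> U} | (f :: real \<Rightarrow> real) U.
        continuous_on UNIV f \<and> bounded (range f) \<and> open U}"

definition represents_law ::
  "(('w \<Rightarrow> real) \<Rightarrow> real) \<Rightarrow> ('w \<Rightarrow> real) \<Rightarrow> real measure set \<Rightarrow> bool" where
  "represents_law E X \<Theta> \<longleftrightarrow>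
     \<Theta> \<noteq> {} \<and> compactin weak_topology \<Theta> \<and>
     (\<forall>\<phi>\<in>CbLip. E (\<lambda>w. \<phi> (X w)) = (SUP M\<in>\<Theta>. LINT x|M. \<phi> x))"

text \<open>
  Extended-real integral of positive part minus integral of negative part.  (The Bochner integral
  would be 0 on non-integrable functions.)
\<close>

definition ext_integral :: "real measure \<Rightarrow> (real \<Rightarrow> real) \<Rightarrow> ereal" where
  "ext_integral M \<psi> =
     enn2ereal (\<integral>\<^sup>+x. ennreal (\<psi> x) \<partial>M) - enn2ereal (\<integral>\<^sup>+x. ennreal (- \<psi> x) \<partial>M)"

definition ext_expectation :: "real measure set \<Rightarrow> (real \<Rightarrow> real) \<Rightarrow> ereal" where
  "ext_expectation \<Theta> \<psi> = (SUP M\<in>\<Theta>. ext_integral M \<psi>)"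


section \<open>The G-normal distribution\<close>

text \<open>\<open>sl\<close> and \<open>su\<close> are the lower and the upper standard deviation.\<close>

definition G_fun :: "real \<Rightarrow> real \<Rightarrow> real \<Rightarrow> real" where
  "G_fun sl su a = (su\<^sup>2 * max a 0 - sl\<^sup>2 * max (- a) 0) / 2"

text \<open>
  Bounded classical solutions \<open>u x t\<close> of the G-heat equation with initial value \<open>\<phi>\<close>; \<open>ut\<close>, \<open>ux\<close>,
  \<open>uxx\<close> are the partial derivatives of \<open>u\<close>.
\<close>

definition G_heat_solution ::
  "real \<Rightarrow> real \<Rightarrow> (real \<Rightarrow> real) \<Rightarrow> (real \<Rightarrow> real \<Rightarrow> real) \<Rightarrow> bool" where
  "G_heat_solution sl su \<phi> u \<longleftrightarrow>
     continuous_on (UNIV \<times> {0..}) (\<lambda>(x, t). u x t) \<and>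
     bounded ((\<lambda>(x, t). u x t) ` (UNIV \<times> {0..})) \<and>
     (\<forall>x. u x 0 = \<phi> x) \<and>
     (\<exists>ut ux uxx.
        continuous_on (UNIV \<times> {0<..}) (\<lambda>(x, t). ut x t) \<and>
        continuous_on (UNIV \<times> {0<..}) (\<lambda>(x, t). ux x t) \<and>
        continuous_on (UNIV \<times> {0<..}) (\<lambda>(x, t). uxx x t) \<and>
        (\<forall>x. \<forall>t>0.
           ((\<lambda>s. u x s) has_real_derivative ut x t) (at t) \<and>
           ((\<lambda>y. u y t) has_real_derivative ux x t) (at x) \<and>
           ((\<lambda>y. ux y t) has_real_derivative uxx x t) (at x) \<and>
           ut x t - G_fun sl su (uxx x t) = 0))"

text \<open>
  For \<open>0 < sl \<le> su\<close> the bounded solution exists and is unique for every bounded Lipschitz initial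
  value, so this determines the functional \<open>N\<close> on \<open>CbLip\<close>.
\<close>

definition G_normal :: "real \<Rightarrow> real \<Rightarrow> ((real \<Rightarrow> real) \<Rightarrow> real) \<Rightarrow> bool" where
  "G_normal sl su N \<longleftrightarrow> (\<forall>\<phi>\<in>CbLip. \<exists>u. G_heat_solution sl su \<phi> u \<and> N \<phi> = u 0 1)"


section \<open>The rate of convergence\<close>

definition normalized_sum :: "(nat \<Rightarrow> 'w \<Rightarrow> real) \<Rightarrow> nat \<Rightarrow> 'w \<Rightarrow> real" where
  "normalized_sum X n w = (\<Sum>i=1..n. X i w) / sqrt (real n)"

text \<open>
  The estimate with exponent \<open>\<alpha>\<close> and constant \<open>C\<close> for all sublinear expectation spaces over
  \<open>'w\<close>.  The moments of \<open>X 1\<close> do not depend on the choice of the representing set \<open>\<Theta>\<close>.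
\<close>

definition CLT_rate :: "'w itself \<Rightarrow> real \<Rightarrow> real \<Rightarrow> real \<Rightarrow> real \<Rightarrow> bool" where
  "CLT_rate (_ :: 'w itself) sl su \<alpha> C \<longleftrightarrow>
     (\<forall>(H :: ('w \<Rightarrow> real) set) E X \<Theta> N.
        sublinear_expectation_space H E \<longrightarrow>
        iid_sequence H E X \<longrightarrow>
        represents_law E (X 1) \<Theta> \<longrightarrow>
        ext_expectation \<Theta> (\<lambda>x. x) = 0 \<longrightarrow>
        ext_expectation \<Theta> (\<lambda>x. - x) = 0 \<longrightarrow>
        ext_expectation \<Theta> (\<lambda>x. x\<^sup>2) = ereal (su\<^sup>2) \<longrightarrow>
        - ext_expectation \<Theta> (\<lambda>x. - (x\<^sup>2)) = ereal (sl\<^sup>2) \<longrightarrow>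
        G_normal sl su N \<longrightarrow>
        (\<forall>n\<ge>1.
           (SUP \<phi>\<in>{\<phi> \<in> CbLip. 1-lipschitz_on UNIV \<phi>}.
              ereal \<bar>E (\<lambda>w. \<phi> (normalized_sum X n w)) - N \<phi>\<bar>)
           \<le> ereal C * ext_expectation \<Theta> (\<lambda>x. \<bar>x\<bar> powr (2 + \<alpha>)) / ereal (real n powr (\<alpha> / 2))))"

text \<open>
  HOL cannot quantify over types inside a formula, so \<open>\<exists>\<alpha> C. CLT_rate TYPE('w) sl su \<alpha> C\<close> alone
  would allow \<open>\<alpha>\<close> and \<open>C\<close> to depend on the sample space \<open>'w\<close>.  Dependence on \<open>sl\<close> and \<open>su\<close> only is
  expressed by obtaining \<open>\<alpha>\<close> and \<open>C\<close> for one fixed sample space, the space of real sequences, and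
  asserting that whatever exponent and constant are valid there are valid over every \<open>'w\<close>.
\<close>

end

theory Submission
  imports Defs
begin

text \<open>
  The proof is Lindeberg's: along the solution \<open>u\<close> of the G-heat equation the error is a sum over
  \<open>j < n\<close> of one-step errors at time \<open>j / n\<close>.  A Taylor expansion bounds them provided that
  \<open>\<bar>uxx x t - uxx y t\<bar> \<le> C * t powr (-3/4) * sqrt \<bar>x - y\<bar>\<close>; the resulting sum gives the rate with
  \<open>\<alpha> = 1 / 2\<close>.

  In one space dimension no deep regularity theory is needed for this.  A time increment
  \<open>w x t = u x (t + h) - u x t\<close> solves a linear equation \<open>wt = a * wxx\<close> whose coefficient is merely
  bounded below by a positive constant.  Doubling of variables, the analytic form of coupling two
  independent one-dimensional diffusions until they meet, shows that \<open>w\<close> becomes Lipschitz in \<open>x\<close>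
  with a constant proportional to its bound.  Hence \<open>ut\<close> is Lipschitz in \<open>x\<close>, and so is \<open>uxx\<close>, because
  \<open>ut = G uxx\<close> and \<open>G\<close> has a Lipschitz inverse.
\<close>

section \<open>Maximum principle and doubling of variables\<close>

text \<open>The equation cannot be differentiated in \<open>x\<close>: \<open>G\<close> has a kink
  at 0, and \<open>u\<close> is only known to have two space derivatives. Time increments need no
  third derivative, and difference quotients of \<open>G\<close> supply their coefficient. The
  obstacle is a circle. The Lipschitz constant of \<open>ut\<close> needs a bound on
  \<open>ut\<close>; that bound comes from interpolating between
  \<open>\<bar>ux\<bar> \<le> 1\<close> and the Lipschitz constant of \<open>uxx\<close>, which
  rests on that of \<open>ut\<close>. The circle closes because the interpolation bounds the square
  of \<open>uxx\<close> by a linear expression, but only once the supremum involved is known to be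
  finite. This is why the test function is replaced by one with bounded second derivative; the bound
  disappears from all later constants, so the replacement costs nothing in the limit. The power -3/4
  comes from \<open>uxx\<close> being of order t^(-1/2) with Lipschitz constant of order 1/t: the
  geometric mean of both bounds is Hoelder with exponent 1/2. Other weights would give any \<alpha>
  in (0,1); 1/2 is a choice. All bounds blow up at time 0, so the step starting from the initial
  value is treated by Lipschitz continuity alone.\<close>

lemma second_derivative_nonpos_at_max:
  fixes f f' :: "real \<Rightarrow> real"
  assumes f: "\<And>y. (f has_real_derivative f' y) (at y)"
    and f': "(f' has_real_derivative D) (at x)"
    and r: "0 < r" "\<And>y. \<bar>y - x\<bar> < r \<Longrightarrow> f y \<le> f x"
  shows "D \<le> 0"
proof (rule ccontr)
  assume "\<not> D \<le> 0"
  then have "D > 0" by simp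
  have z: "f' x = 0"
    by (rule DERIV_local_max[OF f r(1)]) (use r(2) in \<open>auto simp: abs_minus_commute\<close>)
  obtain d where d: "d > 0" "\<And>h. 0 < h \<Longrightarrow> h < d \<Longrightarrow> f' x < f' (x + h)"
    using DERIV_pos_inc_right[OF f' \<open>D > 0\<close>] by auto
  define e where "e = min d r / 2"
  have e: "0 < e" "e < d" "e < r" using d(1) r(1) by (auto simp: e_def)
  obtain c where c: "x < c" "c < x + e" "f (x + e) - f x = (x + e - x) * f' c"
    using MVT2[of x "x + e" f f'] f e(1) by auto
  have "f' c > 0" using d(2)[of "c - x"] c e z by auto
  then have "f (x + e) > f x" using c(3) e(1) by (simp add: field_simps) 
  with r(2)[of "x + e"] e show False by auto
qed

text \<open>Only points to the left are compared, because in the parabolic arguments the maximum may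
  lie at the final time.\<close>

lemma derivative_nonneg_at_left_max:
  fixes f :: "real \<Rightarrow> real"
  assumes f: "(f has_real_derivative D) (at x)"
    and r: "0 < r" "\<And>y. x - r < y \<Longrightarrow> y \<le> x \<Longrightarrow> f y \<le> f x"
  shows "0 \<le> D"
proof (rule ccontr)
  assume "\<not> 0 \<le> D"
  then obtain d where d: "d > 0" "\<And>h. 0 < h \<Longrightarrow> h < d \<Longrightarrow> f x < f (x - h)"
    using DERIV_neg_dec_left[OF f] by auto
  have "f x < f (x - min d r / 2)" using d r(1) by auto
  moreover have "f (x - min d r / 2) \<le> f x" using r d(1) by (intro r(2)) auto
  ultimately show False by simp
qed

text \<open>The inequality \<open>sub\<close> is what remains when two solutions of the nonlinear
  equation are subtracted, so no coefficient appears. A bounded function on the line need not attain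
  its supremum; subtracting \<open>\<epsilon> * x\<^sup>2\<close> forces a maximum, and subtracting
  \<open>b * t\<close> makes the inequality there strict.\<close>

lemma parabolic_maximum_principle:
  fixes w wt wx wxx :: "real \<Rightarrow> real \<Rightarrow> real"
  assumes cont: "continuous_on (UNIV \<times> {0..T}) (\<lambda>(x, t). w x t)"
    and bdd: "\<And>x t. 0 \<le> t \<Longrightarrow> t \<le> T \<Longrightarrow> w x t \<le> B"
    and dt: "\<And>x t. 0 < t \<Longrightarrow> t \<le> T \<Longrightarrow> ((\<lambda>s. w x s) has_real_derivative wt x t) (at t)"
    and dx: "\<And>x t. 0 < t \<Longrightarrow> t \<le> T \<Longrightarrow> ((\<lambda>y. w y t) has_real_derivative wx x t) (at x)"
    and dxx: "\<And>x t. 0 < t \<Longrightarrow> t \<le> T \<Longrightarrow> ((\<lambda>y. wx y t) has_real_derivative wxx x t) (at x)"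
    and sub: "\<And>x t. 0 < t \<Longrightarrow> t \<le> T \<Longrightarrow> wt x t \<le> \<Lambda> * max (wxx x t) 0"
    and "0 \<le> \<Lambda>"
    and init: "\<And>x. w x 0 \<le> m"
    and t0: "0 \<le> t0" "t0 \<le> T"
  shows "w x0 t0 \<le> m"
proof (rule ccontr)
  assume "\<not> w x0 t0 \<le> m"
  then have gt: "w x0 t0 - m > 0" by simp
  \<comment> \<open>As \<open>\<epsilon> * q = w x0 t0 - m\<close> and \<open>q\<close> contains the
    summand 1, the penalised function still exceeds \<open>m\<close> by \<open>\<epsilon>\<close> at
    \<open>(x0, t0)\<close>. The time slope \<open>b\<close> beats the
    \<open>\<Lambda> * (2 * \<epsilon>)\<close> which the spatial penalty costs.\<close>
  define q where "q = x0\<^sup>2 + (2 * \<Lambda> + 1) * t0 + 1"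
  define \<epsilon> where "\<epsilon> = (w x0 t0 - m) / q"
  define b where "b = \<epsilon> * (2 * \<Lambda> + 1)"
  have "x0\<^sup>2 \<ge> 0" "(2 * \<Lambda> + 1) * t0 \<ge> 0" using \<open>0 \<le> \<Lambda>\<close> t0 by auto
  then have q: "q > 0" unfolding q_def by linarith
  have \<epsilon>: "\<epsilon> > 0" using gt q by (simp add: \<epsilon>_def)
  have b: "b > 0" using \<epsilon> \<open>0 \<le> \<Lambda>\<close> by (simp add: b_def)
  define \<Phi> where "\<Phi> = (\<lambda>x t. w x t - \<epsilon> * x\<^sup>2 - b * t)"
  have "\<epsilon> * q = w x0 t0 - m" using q by (simp add: \<epsilon>_def)
  then have \<Phi>0: "\<Phi> x0 t0 > m" using \<epsilon> by (simp add: q_def \<Phi>_def b_def algebra_simps)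
  \<comment> \<open>At distance \<open>R\<close> from the origin the penalty has reached
    \<open>B - m\<close>, so the maximum does not lie on the lateral boundary.\<close>
  define R where "R = \<bar>x0\<bar> + 1 + (\<bar>B - m\<bar>) / \<epsilon>"
  have R: "R \<ge> 1" "R > \<bar>x0\<bar>" "R \<ge> \<bar>B - m\<bar> / \<epsilon>" 
  proof -
    have "\<bar>B - m\<bar> / \<epsilon> \<ge> 0" using \<epsilon> by simp
    then show "R \<ge> 1" "R > \<bar>x0\<bar>" "R \<ge> \<bar>B - m\<bar> / \<epsilon>" by (auto simp: R_def)
  qed
  have "R\<^sup>2 \<ge> R" using R(1) by (simp add: power2_eq_square)
  then have "\<epsilon> * R\<^sup>2 \<ge> \<epsilon> * (\<bar>B - m\<bar> / \<epsilon>)" using \<epsilon> R(3) by (intro mult_left_mono) auto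
  then have R2: "\<epsilon> * R\<^sup>2 \<ge> B - m" using \<epsilon> by simp
  have "continuous_on ({-R..R} \<times> {0..T}) (\<lambda>(x, t). \<Phi> x t)"
    unfolding \<Phi>_def case_prod_beta
    by (intro continuous_intros continuous_on_subset[OF cont[unfolded case_prod_beta]]) auto
  moreover have ne: "(x0, t0) \<in> {-R..R} \<times> {0..T}" using R t0 by auto
  ultimately obtain p where p: "p \<in> {-R..R} \<times> {0..T}"
    "\<And>q. q \<in> {-R..R} \<times> {0..T} \<Longrightarrow> (\<lambda>(x, t). \<Phi> x t) q \<le> (\<lambda>(x, t). \<Phi> x t) p"
    using continuous_attains_sup[of "{-R..R} \<times> {0..T}" "\<lambda>(x, t). \<Phi> x t"]
    by (metis compact_Icc compact_Times empty_iff)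
  obtain x t where p': "p = (x, t)" by force
  have xt: "-R \<le> x" "x \<le> R" "0 \<le> t" "t \<le> T" using p(1) p' by auto
  have mx: "\<Phi> y s \<le> \<Phi> x t" if "-R \<le> y" "y \<le> R" "0 \<le> s" "s \<le> T" for y s
    using p(2)[of "(y, s)"] that p' by auto
  have big: "\<Phi> x t > m" using mx[of x0 t0] \<Phi>0 R t0 by (auto simp: abs_less_iff)
  have "t \<noteq> 0" using big init[of x] \<epsilon> by (auto simp: \<Phi>_def) (smt (verit) zero_le_power2 mult_nonneg_nonneg)
  with xt have t: "0 < t" by simp
  have "\<bar>x\<bar> \<noteq> R"
  proof
    assume "\<bar>x\<bar> = R"
    then have "x\<^sup>2 = R\<^sup>2" by (metis power2_abs)
    moreover have "b * t \<ge> 0" using b xt by simp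
    ultimately show False using big bdd[OF xt(3,4), of x] R2 by (simp add: \<Phi>_def)
  qed
  with xt have x: "\<bar>x\<bar> < R" by auto
  have "wxx x t - 2 * \<epsilon> \<le> 0"
  proof (rule second_derivative_nonpos_at_max[where r="R - \<bar>x\<bar>" and x=x])
    show "((\<lambda>y. \<Phi> y t) has_real_derivative (wx y t - 2 * \<epsilon> * y)) (at y)" for y
      unfolding \<Phi>_def by (auto intro!: derivative_eq_intros dx t xt)
    show "((\<lambda>y. wx y t - 2 * \<epsilon> * y) has_real_derivative wxx x t - 2 * \<epsilon>) (at x)"
      by (auto intro!: derivative_eq_intros dxx t xt)
  qed (use x mx xt in auto)
  moreover have "0 \<le> wt x t - b"
  proof (rule derivative_nonneg_at_left_max[where r=t and x=t])
    show "((\<lambda>s. \<Phi> x s) has_real_derivative (wt x t - b)) (at t)"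
      unfolding \<Phi>_def by (auto intro!: derivative_eq_intros dt t xt)
  qed (use mx xt t in auto)
  moreover have "\<Lambda> * max (wxx x t) 0 \<le> \<Lambda> * (2 * \<epsilon>)"
    using calculation(1) \<epsilon> \<open>0 \<le> \<Lambda>\<close> by (intro mult_left_mono) auto
  ultimately show False using sub[OF t xt(4), of x] \<epsilon> by (simp add: b_def algebra_simps)
qed

text \<open>
  Kruzhkov's doubling of variables: \<open>w x t - w y t\<close> is compared on the strip \<open>0 \<le> x - y \<le> R\<close>,
  where \<open>R\<^sup>2 = \<tau>\<close>, with a function of \<open>x - y\<close> and \<open>t\<close> that is concave in \<open>x - y\<close>.  No
  mixed second derivative occurs, so nothing is needed about the coefficient \<open>wt / wxx\<close> except its
  lower bound \<open>\<lambda>\<close>.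
\<close>

lemma doubling_one_sided:
  fixes w wt wx wxx :: "real \<Rightarrow> real \<Rightarrow> real"
  assumes cont: "continuous_on (UNIV \<times> {0..\<tau>}) (\<lambda>(x, t). w x t)"
    and bdd: "\<And>x t. 0 \<le> t \<Longrightarrow> t \<le> \<tau> \<Longrightarrow> \<bar>w x t\<bar> \<le> B"
    and dt: "\<And>x t. 0 < t \<Longrightarrow> t \<le> \<tau> \<Longrightarrow> ((\<lambda>s. w x s) has_real_derivative wt x t) (at t)"
    and dx: "\<And>x t. 0 < t \<Longrightarrow> t \<le> \<tau> \<Longrightarrow> ((\<lambda>y. w y t) has_real_derivative wx x t) (at x)"
    and dxx: "\<And>x t. 0 < t \<Longrightarrow> t \<le> \<tau> \<Longrightarrow> ((\<lambda>y. wx y t) has_real_derivative wxx x t) (at x)"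
    and neg: "\<And>x t. 0 < t \<Longrightarrow> t \<le> \<tau> \<Longrightarrow> wxx x t \<le> 0 \<Longrightarrow> wt x t \<le> l * wxx x t"
    and pos: "\<And>x t. 0 < t \<Longrightarrow> t \<le> \<tau> \<Longrightarrow> 0 \<le> wxx x t \<Longrightarrow> l * wxx x t \<le> wt x t"
    and "0 < l" "0 < B" "0 < \<tau>"
    and "y0 \<le> x0"
  shows "w x0 \<tau> - w y0 \<tau> \<le> 4 * (1 + 1 / (2 * l)) * B * (x0 - y0) / sqrt \<tau>"
proof -
  define c where "c = 1 + 1 / (2 * l)"
  define R where "R = sqrt \<tau>"
  have c: "c > 1" using \<open>0 < l\<close> by (simp add: c_def)
  have R: "R > 0" "R\<^sup>2 = \<tau>" using \<open>0 < \<tau>\<close> by (auto simp: R_def)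
  \<comment> \<open>The barrier dominates \<open>w x t - w y t\<close> on the boundary: it is at
    least \<open>2 * B\<close> for \<open>z = R\<close> (as \<open>c \<ge> 1\<close>) and for
    \<open>t = 0\<close>, and nonnegative for \<open>z = 0\<close>. Its second derivative in
    \<open>z\<close> is \<open>- 4 * B * c / \<tau>\<close>, its time derivative
    \<open>- 2 * B / \<tau>\<close>; \<open>c\<close> is chosen so that \<open>l\<close> times the
    concavity, counted once for each of \<open>x\<close> and \<open>y\<close>, outweighs the latter.
    At time \<open>\<tau>\<close> it lies below \<open>4 * c * B * z / R\<close>.\<close>
  define \<psi> where "\<psi> = (\<lambda>z t. 2 * B * (c * (2 * z / R - z\<^sup>2 / \<tau>) + (\<tau> - t) / \<tau>))"
  have conc: "2 * z / R - z\<^sup>2 / \<tau> = (z / R) * (2 - z / R)" for z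
    using R by (simp add: power2_eq_square field_simps R(2)[symmetric])
  have \<psi>_nonneg: "\<psi> z t \<ge> 0" if "0 \<le> z" "z \<le> R" "t \<le> \<tau>" for z t
  proof -
    have "z / R \<le> 1" "0 \<le> z / R" using that R by auto
    then show ?thesis using that c \<open>0 < B\<close> \<open>0 < \<tau>\<close> unfolding \<psi>_def conc
      by (intro mult_nonneg_nonneg add_nonneg_nonneg divide_nonneg_nonneg) auto
  qed
  consider "x0 - y0 \<ge> R" | "x0 - y0 < R" "w x0 \<tau> - w y0 \<tau> \<le> \<psi> (x0 - y0) \<tau>"
    | "x0 - y0 < R" "w x0 \<tau> - w y0 \<tau> > \<psi> (x0 - y0) \<tau>" by linarith
  then have "w x0 \<tau> - w y0 \<tau> \<le> 4 * c * B * (x0 - y0) / R"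
  proof cases
    case 1
    have "1 \<le> (x0 - y0) / R" using 1 R by simp
    then have "4 * c * B * 1 \<le> 4 * c * B * ((x0 - y0) / R)"
      using c \<open>0 < B\<close> by (intro mult_left_mono) auto
    moreover have "2 * B \<le> 4 * c * B" using c \<open>0 < B\<close> by simp
    moreover have "w x0 \<tau> - w y0 \<tau> \<le> 2 * B" using bdd[of \<tau> x0] bdd[of \<tau> y0] \<open>0 < \<tau>\<close> by auto
    ultimately have "w x0 \<tau> - w y0 \<tau> \<le> 4 * c * B * ((x0 - y0) / R)" by linarith
    then show ?thesis by simp
  next
    case 2
    have "\<psi> (x0 - y0) \<tau> \<le> 2 * B * (c * (2 * (x0 - y0) / R))"
    proof -
      have "c * (2 * (x0 - y0) / R - (x0 - y0)\<^sup>2 / \<tau>) \<le> c * (2 * (x0 - y0) / R)"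
        using c \<open>0 < \<tau>\<close> by (intro mult_left_mono) auto
      then show ?thesis unfolding \<psi>_def using \<open>0 < B\<close> by (intro mult_left_mono) auto
    qed
    with 2 show ?thesis by (simp add: mult_ac)
  next
    case 3
    define g where "g = w x0 \<tau> - w y0 \<tau> - \<psi> (x0 - y0) \<tau>"
    have g: "g > 0" using 3 by (simp add: g_def)
    \<comment> \<open>The second bound keeps the penalised function positive at
      \<open>(x0, y0, \<tau>)\<close>. The first keeps the penalty smaller than the concavity of the
      barrier, so that \<open>s \<le> 0\<close> below.\<close>
    define \<epsilon> where "\<epsilon> = min (B / \<tau>) (g / (x0\<^sup>2 + y0\<^sup>2 + 1))"
    have q: "x0\<^sup>2 + y0\<^sup>2 + 1 > 0" by (smt (verit) zero_le_power2)
    have \<epsilon>: "\<epsilon> > 0" "\<epsilon> \<le> B / \<tau>" "\<epsilon> \<le> g / (x0\<^sup>2 + y0\<^sup>2 + 1)"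
      using g q \<open>0 < B\<close> \<open>0 < \<tau>\<close> by (auto simp: \<epsilon>_def)
    define \<Phi> where "\<Phi> = (\<lambda>x y t. w x t - w y t - \<psi> (x - y) t - \<epsilon> * (x\<^sup>2 + y\<^sup>2))"
    have "\<epsilon> * (x0\<^sup>2 + y0\<^sup>2 + 1) \<le> g" using \<epsilon>(3) q by (simp add: field_simps)
    then have \<Phi>0: "\<Phi> x0 y0 \<tau> > 0" using \<epsilon>(1) by (simp add: \<Phi>_def g_def algebra_simps)
    define Q where "Q = \<bar>x0\<bar> + \<bar>y0\<bar> + 1 + 2 * B / \<epsilon>"
    have Q: "Q \<ge> 1" "Q \<ge> \<bar>x0\<bar>" "Q \<ge> \<bar>y0\<bar>" "Q \<ge> 2 * B / \<epsilon>"
      using \<epsilon> \<open>0 < B\<close> by (auto simp: Q_def)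
    have "Q\<^sup>2 \<ge> Q" using Q(1) by (simp add: power2_eq_square)
    then have "\<epsilon> * Q\<^sup>2 \<ge> \<epsilon> * (2 * B / \<epsilon>)" using \<epsilon> Q(4) by (intro mult_left_mono) auto
    then have Q2: "\<epsilon> * Q\<^sup>2 \<ge> 2 * B" using \<epsilon> by simp
    define K where "K = ({-Q..Q} \<times> {-Q..Q} \<times> {0..\<tau>}) \<inter> {p. 0 \<le> fst p - fst (snd p)} \<inter>
      {p. fst p - fst (snd p) \<le> R}"
    have "compact K" unfolding K_def
      by (intro compact_Int_closed closed_Collect_le compact_Times compact_Icc continuous_intros)
    moreover have in_K: "(x, y, t) \<in> K \<longleftrightarrow>
      -Q \<le> x \<and> x \<le> Q \<and> -Q \<le> y \<and> y \<le> Q \<and> 0 \<le> t \<and> t \<le> \<tau> \<and> 0 \<le> x - y \<and> x - y \<le> R" for x y t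
      by (auto simp: K_def)
    moreover have "continuous_on K (\<lambda>(x, y, t). \<Phi> x y t)"
    proof -
      have 1: "continuous_on K (\<lambda>p. w (fst p) (snd (snd p)))"
        by (rule continuous_on_compose2[OF cont, of K "\<lambda>p. (fst p, snd (snd p))", simplified])
          (auto intro!: continuous_intros simp: K_def)
      have 2: "continuous_on K (\<lambda>p. w (fst (snd p)) (snd (snd p)))"
        by (rule continuous_on_compose2[OF cont, of K snd, unfolded case_prod_beta])
          (auto intro!: continuous_intros simp: K_def)
      show ?thesis
        unfolding \<Phi>_def \<psi>_def case_prod_beta
        by (intro continuous_intros 1 2) (use R \<open>0 < \<tau>\<close> in auto)
    qed
    moreover have "(x0, y0, \<tau>) \<in> K"
      using Q 3 \<open>y0 \<le> x0\<close> \<open>0 < \<tau>\<close> by (auto simp: in_K)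
    ultimately obtain p where p: "p \<in> K" "\<And>q. q \<in> K \<Longrightarrow> (\<lambda>(x, y, t). \<Phi> x y t) q \<le> (\<lambda>(x, y, t). \<Phi> x y t) p"
      using continuous_attains_sup[of K "\<lambda>(x, y, t). \<Phi> x y t"] by (metis empty_iff)
    obtain x y t where p': "p = (x, y, t)" by (metis prod_cases3)
    have xt: "-Q \<le> x" "x \<le> Q" "-Q \<le> y" "y \<le> Q" "0 \<le> t" "t \<le> \<tau>" "0 \<le> x - y" "x - y \<le> R"
      using p(1) by (auto simp: in_K p')
    have mx: "\<Phi> x' y' t' \<le> \<Phi> x y t" if "(x', y', t') \<in> K" for x' y' t'
      using p(2)[OF that] p' by simp
    have big: "\<Phi> x y t > 0" using mx[OF \<open>(x0, y0, \<tau>) \<in> K\<close>] \<Phi>0 by simp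
    have w2: "w x t - w y t \<le> 2 * B" using bdd[OF xt(5,6), of x] bdd[OF xt(5,6), of y] by auto
    have e0: "\<epsilon> * (x\<^sup>2 + y\<^sup>2) \<ge> 0" using \<epsilon> by simp
    have \<psi>xy: "\<psi> (x - y) t < 2 * B" using big w2 e0 by (simp add: \<Phi>_def)
    have \<psi>0: "\<psi> (x - y) t \<ge> 0" using \<psi>_nonneg xt by auto
    have "(x - y) / R \<le> 1" "(x - y) / R \<ge> 0" using xt R by auto
    then have "(x - y) / R * (2 - (x - y) / R) \<ge> 0" by (intro mult_nonneg_nonneg) auto
    then have cz: "c * (2 * (x - y) / R - (x - y)\<^sup>2 / \<tau>) \<ge> 0" 
      unfolding conc using c by (intro mult_nonneg_nonneg[of c]) auto
    have "t \<noteq> 0"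
    proof
      assume "t = 0"
      then have "\<psi> (x - y) t = 2 * B * (c * (2 * (x - y) / R - (x - y)\<^sup>2 / \<tau>) + 1)"
        using \<open>0 < \<tau>\<close> by (simp add: \<psi>_def)
      also have "\<dots> \<ge> 2 * B * 1" using cz \<open>0 < B\<close> by (intro mult_left_mono) auto
      finally show False using \<psi>xy by simp
    qed
    then have t: "0 < t" using xt by simp
    have "x - y \<noteq> R"
    proof
      assume "x - y = R"
      then have "\<psi> (x - y) t = 2 * B * (c + (\<tau> - t) / \<tau>)"
        using R \<open>0 < \<tau>\<close> by (simp add: \<psi>_def power2_eq_square)
      also have "\<dots> \<ge> 2 * B * 1" using c xt \<open>0 < B\<close> \<open>0 < \<tau>\<close>
        by (intro mult_left_mono) (auto intro: add_increasing2)
      finally show False using \<psi>xy by simp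
    qed
    moreover have "x - y \<noteq> 0"
    proof
      assume "x - y = 0"
      then have "x = y" by simp
      then show False using big \<psi>0 e0 by (simp add: \<Phi>_def)
    qed
    ultimately have z: "0 < x - y" "x - y < R" using xt by auto
    have notQ: "r\<^sup>2 < Q\<^sup>2" if "r\<^sup>2 \<le> x\<^sup>2 + y\<^sup>2" for r
    proof (rule ccontr)
      assume "\<not> r\<^sup>2 < Q\<^sup>2"
      then have "\<epsilon> * Q\<^sup>2 \<le> \<epsilon> * (x\<^sup>2 + y\<^sup>2)" using that \<epsilon> by (intro mult_left_mono) auto
      then show False using big w2 \<psi>0 Q2 by (simp add: \<Phi>_def)
    qed
    have x: "\<bar>x\<bar> < Q" "\<bar>y\<bar> < Q"
      using notQ[of x] notQ[of y] Q(1) by (auto intro: power2_less_imp_less[of "\<bar>x\<bar>" Q] power2_less_imp_less[of "\<bar>y\<bar>" Q])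
    define s where "s = 2 * \<epsilon> - 4 * B * c / \<tau>"
    define r where "r = min (min (Q - \<bar>x\<bar>) (Q - \<bar>y\<bar>)) (min (x - y) (R - (x - y)))"
    have r: "r > 0" using x z by (simp add: r_def)
    have "R \<noteq> 0" "\<tau> \<noteq> 0" using R \<open>0 < \<tau>\<close> by auto
    define p where "p = (\<lambda>z. 2 * B * (c * (2 / R - 2 * z / \<tau>)))"
    have \<psi>x: "((\<lambda>x. \<psi> (x - y) t) has_real_derivative p (x - y)) (at x)" for x
      unfolding \<psi>_def p_def using \<open>R \<noteq> 0\<close> \<open>\<tau> \<noteq> 0\<close> by (auto intro!: derivative_eq_intros)
    have \<psi>y: "((\<lambda>y. \<psi> (x - y) t) has_real_derivative - p (x - y)) (at y)" for y
      unfolding \<psi>_def p_def using \<open>R \<noteq> 0\<close> \<open>\<tau> \<noteq> 0\<close>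
      by (auto intro!: derivative_eq_intros simp: field_simps)
    have \<psi>t: "((\<lambda>s. \<psi> (x - y) s) has_real_derivative - (2 * B / \<tau>)) (at t)"
      unfolding \<psi>_def using \<open>\<tau> \<noteq> 0\<close> by (auto intro!: derivative_eq_intros)
    have px: "((\<lambda>x. p (x - y)) has_real_derivative - (4 * B * c / \<tau>)) (at x)"
      unfolding p_def using \<open>\<tau> \<noteq> 0\<close> by (auto intro!: derivative_eq_intros)
    have py: "((\<lambda>y. p (x - y)) has_real_derivative 4 * B * c / \<tau>) (at y)"
      unfolding p_def using \<open>\<tau> \<noteq> 0\<close> by (auto intro!: derivative_eq_intros)
    have sx: "wxx x t - s \<le> 0"
    proof (rule second_derivative_nonpos_at_max[where r=r and x=x])
      show "((\<lambda>x. \<Phi> x y t) has_real_derivative (wx x t - p (x - y) - 2 * \<epsilon> * x)) (at x)" for x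
        unfolding \<Phi>_def by (auto intro!: derivative_eq_intros \<psi>x dx t xt)
      show "((\<lambda>x. wx x t - p (x - y) - 2 * \<epsilon> * x) has_real_derivative wxx x t - s) (at x)"
        unfolding s_def by (auto intro!: derivative_eq_intros px dxx t xt)
      show "\<Phi> x' y t \<le> \<Phi> x y t" if "\<bar>x' - x\<bar> < r" for x'
        by (rule mx) (use that x xt z in \<open>auto simp: in_K r_def abs_less_iff\<close>)
    qed (use r in auto)
    have sy: "- wxx y t - s \<le> 0"
    proof (rule second_derivative_nonpos_at_max[where r=r and x=y])
      show "((\<lambda>y. \<Phi> x y t) has_real_derivative (- wx y t + p (x - y) - 2 * \<epsilon> * y)) (at y)" for y
        unfolding \<Phi>_def by (auto intro!: derivative_eq_intros \<psi>y dx t xt)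
      show "((\<lambda>y. - wx y t + p (x - y) - 2 * \<epsilon> * y) has_real_derivative - wxx y t - s) (at y)"
        unfolding s_def by (auto intro!: derivative_eq_intros py dxx t xt)
      show "\<Phi> x y' t \<le> \<Phi> x y t" if "\<bar>y' - y\<bar> < r" for y'
        by (rule mx) (use that x xt z in \<open>auto simp: in_K r_def abs_less_iff\<close>)
    qed (use r in auto)
    have st: "0 \<le> wt x t - wt y t + 2 * B / \<tau>"
    proof (rule derivative_nonneg_at_left_max[where r=t and x=t])
      show "((\<lambda>s. \<Phi> x y s) has_real_derivative (wt x t - wt y t + 2 * B / \<tau>)) (at t)"
        unfolding \<Phi>_def by (auto intro!: derivative_eq_intros \<psi>t dt t xt)
    qed (use mx xt t in \<open>auto simp: in_K\<close>)
    have "B / \<tau> > 0" using \<open>0 < B\<close> \<open>0 < \<tau>\<close> by simp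
    have sB: "s = 2 * \<epsilon> - 4 * (B / \<tau>) * c" by (simp add: s_def)
    have "s \<le> 2 * \<epsilon> - 4 * (B / \<tau>) * 1"
      unfolding sB using c \<open>B / \<tau> > 0\<close> by (intro diff_left_mono mult_left_mono) auto
    then have s: "s \<le> 0" using \<epsilon>(2) \<open>B / \<tau> > 0\<close> by simp
    \<comment> \<open>At the maximum \<open>wxx x t \<le> s \<le> 0 \<le> - s \<le> wxx y t\<close>.
      The signs are therefore those that \<open>neg\<close> requires at \<open>x\<close> and
      \<open>pos\<close> at \<open>y\<close>.\<close>
    have "l * wxx x t \<le> l * s" "l * - wxx y t \<le> l * s"
      using sx sy \<open>0 < l\<close> by (intro mult_left_mono; simp)+
    then have "wt x t \<le> l * s" "- wt y t \<le> l * s"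
      using neg[OF t xt(6), of x] pos[OF t xt(6), of y] sx sy s by auto
    then have "0 \<le> 2 * (l * s) + 2 * (B / \<tau>)" using st by simp
    also have "l * s = 2 * (l * \<epsilon>) - 4 * (B / \<tau>) * (l * c)" by (simp add: sB algebra_simps)
    also have "l * c = l + 1 / 2" using \<open>0 < l\<close> by (simp add: c_def field_simps)
    also have "l * \<epsilon> \<le> l * (B / \<tau>)" using \<epsilon> \<open>0 < l\<close> by (intro mult_left_mono) auto
    finally have "0 \<le> 2 * (2 * (l * (B / \<tau>)) - 4 * (B / \<tau>) * (l + 1 / 2)) + 2 * (B / \<tau>)"
      by simp
    also have "2 * (2 * (l * b) - 4 * b * (l + 1 / 2)) + 2 * b = - 4 * (l * b) - 2 * b" for b
      by (simp add: algebra_simps)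
    finally have "0 \<le> - 4 * (l * (B / \<tau>)) - 2 * (B / \<tau>)" .
    then show ?thesis using \<open>B / \<tau> > 0\<close> \<open>0 < l\<close> by (smt (verit) mult_pos_pos)
  qed
  then show ?thesis by (simp add: c_def R_def)
qed

text \<open>The hypotheses are invariant under \<open>w \<mapsto> - w\<close>, which exchanges
  \<open>neg\<close> and \<open>pos\<close>; the one-sided estimate for both signs gives the
  absolute value.\<close>

lemma doubling_lipschitz:
  fixes w wt wx wxx :: "real \<Rightarrow> real \<Rightarrow> real"
  assumes cont: "continuous_on (UNIV \<times> {0..\<tau>}) (\<lambda>(x, t). w x t)"
    and bdd: "\<And>x t. 0 \<le> t \<Longrightarrow> t \<le> \<tau> \<Longrightarrow> \<bar>w x t\<bar> \<le> B"
    and dt: "\<And>x t. 0 < t \<Longrightarrow> t \<le> \<tau> \<Longrightarrow> ((\<lambda>s. w x s) has_real_derivative wt x t) (at t)"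
    and dx: "\<And>x t. 0 < t \<Longrightarrow> t \<le> \<tau> \<Longrightarrow> ((\<lambda>y. w y t) has_real_derivative wx x t) (at x)"
    and dxx: "\<And>x t. 0 < t \<Longrightarrow> t \<le> \<tau> \<Longrightarrow> ((\<lambda>y. wx y t) has_real_derivative wxx x t) (at x)"
    and neg: "\<And>x t. 0 < t \<Longrightarrow> t \<le> \<tau> \<Longrightarrow> wxx x t \<le> 0 \<Longrightarrow> wt x t \<le> l * wxx x t"
    and pos: "\<And>x t. 0 < t \<Longrightarrow> t \<le> \<tau> \<Longrightarrow> 0 \<le> wxx x t \<Longrightarrow> l * wxx x t \<le> wt x t"
    and "0 < l" "0 < B" "0 < \<tau>"
  shows "\<bar>w x \<tau> - w y \<tau>\<bar> \<le> 4 * (1 + 1 / (2 * l)) * B * \<bar>x - y\<bar> / sqrt \<tau>"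
proof -
  have *: "\<bar>w x \<tau> - w y \<tau>\<bar> \<le> 4 * (1 + 1 / (2 * l)) * B * (x - y) / sqrt \<tau>" if "y \<le> x" for x y
  proof -
    have "w x \<tau> - w y \<tau> \<le> 4 * (1 + 1 / (2 * l)) * B * (x - y) / sqrt \<tau>"
      by (rule doubling_one_sided[OF assms that])
    moreover have "- w x \<tau> - - w y \<tau> \<le> 4 * (1 + 1 / (2 * l)) * B * (x - y) / sqrt \<tau>"
    proof (rule doubling_one_sided[where w="\<lambda>x t. - w x t" and wt="\<lambda>x t. - wt x t"
          and wx="\<lambda>x t. - wx x t" and wxx="\<lambda>x t. - wxx x t"])
      show "continuous_on (UNIV \<times> {0..\<tau>}) (\<lambda>(x, t). - w x t)"
        using continuous_on_minus[OF cont] by (simp add: case_prod_beta)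
    qed (use assms that in \<open>auto intro: DERIV_minus\<close>)
    ultimately show ?thesis by linarith
  qed
  show ?thesis
  proof (cases "y \<le> x")
    case True
    with *[of y x] show ?thesis by simp
  next
    case False
    with *[of x y] show ?thesis by (simp add: abs_minus_commute)
  qed
qed

section \<open>The G-heat flow\<close>

text \<open>\<open>G\<close> is piecewise linear with slopes sl^2/2 and su^2/2. The lower slope
  provides ellipticity and the Lipschitz inverse, the upper one the constant
  \<open>\<Lambda>\<close> of the maximum principle.\<close>

lemma G_fun_diff_bounds:
  fixes sl su :: real
  assumes "0 < sl" "sl \<le> su" "p \<le> q"
  shows "sl\<^sup>2 / 2 * (q - p) \<le> G_fun sl su q - G_fun sl su p"
    and "G_fun sl su q - G_fun sl su p \<le> su\<^sup>2 / 2 * (q - p)"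
proof -
  have le: "sl\<^sup>2 \<le> su\<^sup>2" using assms by (simp add: power_mono)
  have mono: "sl\<^sup>2 * a \<le> su\<^sup>2 * a" if "a \<ge> 0" for a
    using le that by (rule mult_right_mono)
  show "sl\<^sup>2 / 2 * (q - p) \<le> G_fun sl su q - G_fun sl su p"
    and "G_fun sl su q - G_fun sl su p \<le> su\<^sup>2 / 2 * (q - p)"
    using mono[of "q - p"] mono[of q] mono[of "- p"] \<open>p \<le> q\<close>
    by (auto simp: G_fun_def max_def field_simps)
qed

lemma G_fun_mono:
  fixes sl su :: real
  assumes "0 < sl" "sl \<le> su" "p \<le> q"
  shows "G_fun sl su p \<le> G_fun sl su q"
proof -
  have "0 \<le> sl\<^sup>2 / 2 * (q - p)" using assms by simp
  with G_fun_diff_bounds(1)[OF assms] show ?thesis by linarith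
qed

lemma G_fun_abs_bounds:
  fixes sl su :: real
  assumes "0 < sl" "sl \<le> su"
  shows "sl\<^sup>2 / 2 * \<bar>q - p\<bar> \<le> \<bar>G_fun sl su q - G_fun sl su p\<bar>"
    and "\<bar>G_fun sl su q - G_fun sl su p\<bar> \<le> su\<^sup>2 / 2 * \<bar>q - p\<bar>"
proof -
  have *: "sl\<^sup>2 / 2 * \<bar>q - p\<bar> \<le> \<bar>G_fun sl su q - G_fun sl su p\<bar> \<and>
    \<bar>G_fun sl su q - G_fun sl su p\<bar> \<le> su\<^sup>2 / 2 * \<bar>q - p\<bar>" if "p \<le> q" for p q
    using G_fun_diff_bounds[OF assms that] G_fun_mono[OF assms that] that by auto
  from *[of p q] *[of q p] show "sl\<^sup>2 / 2 * \<bar>q - p\<bar> \<le> \<bar>G_fun sl su q - G_fun sl su p\<bar>"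
    and "\<bar>G_fun sl su q - G_fun sl su p\<bar> \<le> su\<^sup>2 / 2 * \<bar>q - p\<bar>"
    by (cases "p \<le> q"; simp add: abs_minus_commute)+
qed

lemma G_fun_0 [simp]: "G_fun sl su 0 = 0"
  by (simp add: G_fun_def)

text \<open>The initial value is read off as \<open>u x 0\<close> instead of being a parameter, so
  that every translate in space and forward in time is again an instance.\<close>

locale G_heat_flow =
  fixes sl su :: real and u ut ux uxx :: "real \<Rightarrow> real \<Rightarrow> real"
  assumes sl_pos: "0 < sl" and sl_le_su: "sl \<le> su"
    and cont: "continuous_on (UNIV \<times> {0..}) (\<lambda>(x, t). u x t)"
    and bdd: "bounded ((\<lambda>(x, t). u x t) ` (UNIV \<times> {0..}))"
    and dt: "0 < t \<Longrightarrow> ((\<lambda>s. u x s) has_real_derivative ut x t) (at t)"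
    and dx: "0 < t \<Longrightarrow> ((\<lambda>y. u y t) has_real_derivative ux x t) (at x)"
    and dxx: "0 < t \<Longrightarrow> ((\<lambda>y. ux y t) has_real_derivative uxx x t) (at x)"
    and eq: "0 < t \<Longrightarrow> ut x t = G_fun sl su (uxx x t)"
begin

lemma su_pos: "0 < su" using sl_pos sl_le_su by simp

lemma bound:
  obtains B where "\<And>x t. 0 \<le> t \<Longrightarrow> \<bar>u x t\<bar> \<le> B"
proof -
  obtain B where "\<forall>p\<in>(\<lambda>(x, t). u x t) ` (UNIV \<times> {0..}). norm p \<le> B"
    using bdd by (auto simp: bounded_iff)
  then have "\<bar>u x t\<bar> \<le> B" if "0 \<le> t" for x t using that by force
  then show ?thesis using that by blast
qed

text \<open>Invariance under translation turns comparison into regularity: comparing a flow with its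
  shift in space preserves the Lipschitz constant, comparing it with its shift in time preserves the
  size of increments.\<close>

lemma translate:
  assumes "0 \<le> h"
  shows "G_heat_flow sl su (\<lambda>x t. u (x + k) (t + h)) (\<lambda>x t. ut (x + k) (t + h))
    (\<lambda>x t. ux (x + k) (t + h)) (\<lambda>x t. uxx (x + k) (t + h))"
proof
  show "continuous_on (UNIV \<times> {0..}) (\<lambda>(x, t). u (x + k) (t + h))"
    unfolding case_prod_beta
    by (rule continuous_on_compose2[OF cont, of _ "\<lambda>p. (fst p + k, snd p + h)", simplified])
      (use assms in \<open>auto intro!: continuous_intros\<close>)
  obtain B where "\<And>x t. 0 \<le> t \<Longrightarrow> \<bar>u x t\<bar> \<le> B" using bound by blast
  then show "bounded ((\<lambda>(x, t). u (x + k) (t + h)) ` (UNIV \<times> {0..}))"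
    using assms by (intro boundedI[of _ B]) auto
  show "((\<lambda>s. u (x + k) (s + h)) has_real_derivative ut (x + k) (t + h)) (at t)"
    if "0 < t" for x t
    using DERIV_shift[of "u (x + k)" "ut (x + k) (t + h)" t h] dt[of "t + h"] that assms by auto
  show "((\<lambda>x. u (x + k) (t + h)) has_real_derivative ux (x + k) (t + h)) (at x)"
    if "0 < t" for x t
    using DERIV_shift[of "\<lambda>x. u x (t + h)" "ux (x + k) (t + h)" x k] dx[of "t + h"] that assms
    by auto
  show "((\<lambda>x. ux (x + k) (t + h)) has_real_derivative uxx (x + k) (t + h)) (at x)"
    if "0 < t" for x t
    using DERIV_shift[of "\<lambda>x. ux x (t + h)" "uxx (x + k) (t + h)" x k] dxx[of "t + h"] that assms
    by auto
qed (use sl_pos sl_le_su eq assms in auto)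

end

text \<open>The comparison principle, and with it uniqueness. Where \<open>uxx\<close> exceeds
  \<open>vxx\<close> the upper slope of \<open>G\<close> bounds \<open>ut - vt\<close>; elsewhere
  monotonicity makes \<open>ut - vt\<close> nonpositive. Together this is the hypothesis
  \<open>sub\<close> of the maximum principle.\<close>

lemma G_heat_flow_diff_le:
  assumes "G_heat_flow sl su u ut ux uxx" "G_heat_flow sl su v vt vx vxx"
    and init: "\<And>x. u x 0 - v x 0 \<le> m" and "0 \<le> t"
  shows "u x t - v x t \<le> m"
proof -
  interpret u: G_heat_flow sl su u ut ux uxx by fact
  interpret v: G_heat_flow sl su v vt vx vxx by fact
  obtain B C where B: "\<And>x t. 0 \<le> t \<Longrightarrow> \<bar>u x t\<bar> \<le> B" and C: "\<And>x t. 0 \<le> t \<Longrightarrow> \<bar>v x t\<bar> \<le> C"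
    using u.bound v.bound by metis
  show ?thesis
  proof (rule parabolic_maximum_principle[where w="\<lambda>x t. u x t - v x t" and wt="\<lambda>x t. ut x t - vt x t"
        and wx="\<lambda>x t. ux x t - vx x t" and wxx="\<lambda>x t. uxx x t - vxx x t" and T=t and \<Lambda>="su\<^sup>2 / 2"])
    show "continuous_on (UNIV \<times> {0..t}) (\<lambda>(x, t). u x t - v x t)"
      using u.cont v.cont unfolding case_prod_beta
      by (intro continuous_on_diff) (auto elim: continuous_on_subset)
    show "u x t - v x t \<le> B + C" if "0 \<le> t" for x t using B[OF that, of x] C[OF that, of x] by auto
    show "ut x s - vt x s \<le> su\<^sup>2 / 2 * max (uxx x s - vxx x s) 0" if "0 < s" for x s
    proof (cases "vxx x s \<le> uxx x s")
      case True
      with G_fun_diff_bounds(2)[OF u.sl_pos u.sl_le_su True] u.eq v.eq that show ?thesis by auto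
    next
      case False
      then have "uxx x s \<le> vxx x s" by simp
      with G_fun_mono[OF u.sl_pos u.sl_le_su this] u.eq v.eq that show ?thesis by auto
    qed
  qed (use assms u.dt u.dx u.dxx v.dt v.dx v.dxx in \<open>auto intro!: DERIV_diff\<close>)
qed

lemma G_heat_flow_abs_diff_le:
  assumes "G_heat_flow sl su u ut ux uxx" "G_heat_flow sl su v vt vx vxx"
    and init: "\<And>x. \<bar>u x 0 - v x 0\<bar> \<le> m" and "0 \<le> t"
  shows "\<bar>u x t - v x t\<bar> \<le> m"
proof -
  have "u x 0 - v x 0 \<le> m" "v x 0 - u x 0 \<le> m" for x
    using init[of x] by auto
  then have "u x t - v x t \<le> m" "v x t - u x t \<le> m"
    using G_heat_flow_diff_le[OF assms(1,2)] G_heat_flow_diff_le[OF assms(2,1)] assms(4) by auto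
  then show ?thesis by simp
qed

context G_heat_flow
begin

lemma G_heat_flow_self: "G_heat_flow sl su u ut ux uxx"
  by (fact G_heat_flow_axioms)

lemma lipschitz_preserved:
  assumes "\<And>x y. \<bar>u x 0 - u y 0\<bar> \<le> L * \<bar>x - y\<bar>" "0 \<le> t"
  shows "\<bar>u x t - u y t\<bar> \<le> L * \<bar>x - y\<bar>"
proof -
  have "\<bar>u (y + (x - y)) (t + 0) - u y t\<bar> \<le> L * \<bar>x - y\<bar>"
    by (rule G_heat_flow_abs_diff_le[OF translate G_heat_flow_self])
      (use assms(1)[of "z + (x - y)" z for z] assms(2) in auto)
  then show ?thesis by simp
qed

lemma time_diff_preserved:
  assumes "\<And>x. \<bar>u x (s + h) - u x s\<bar> \<le> m" "0 \<le> h" "0 \<le> s" "s \<le> t"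
  shows "\<bar>u x (t + h) - u x t\<bar> \<le> m"
proof -
  have "\<bar>u (x + 0) ((t - s) + (s + h)) - u (x + 0) ((t - s) + s)\<bar> \<le> m"
    by (rule G_heat_flow_abs_diff_le[OF translate translate]) (use assms in auto)
  then show ?thesis by simp
qed

text \<open>Barriers: \<open>\<bar>G_fun sl su (f'' x)\<bar> \<le> b\<close> makes
  \<open>u x 0 + b * t\<close> a supersolution and \<open>u x 0 - b * t\<close> a
  subsolution.\<close>

lemma initial_time_diff:
  assumes f: "\<And>x. ((\<lambda>x. u x 0) has_real_derivative f' x) (at x)"
    and f': "\<And>x. (f' has_real_derivative f'' x) (at x)"
    and K: "\<And>x. \<bar>f'' x\<bar> \<le> K" and "0 \<le> h"
  shows "\<bar>u x h - u x 0\<bar> \<le> su\<^sup>2 / 2 * K * h"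
proof -
  obtain B where B: "\<And>x t. 0 \<le> t \<Longrightarrow> \<bar>u x t\<bar> \<le> B" using bound by blast
  have "0 \<le> K" using K[of 0] by simp
  have K2: "\<bar>G_fun sl su (f'' x)\<bar> \<le> su\<^sup>2 / 2 * K" for x
    using G_fun_abs_bounds(2)[OF sl_pos sl_le_su, of "f'' x" 0] K[of x]
      mult_left_mono[of "\<bar>f'' x\<bar>" K "su\<^sup>2 / 2"] by auto
  define b where "b = su\<^sup>2 / 2 * K"
  have b: "b \<ge> 0" using \<open>0 \<le> K\<close> by (simp add: b_def)
  have cont0: "continuous_on (UNIV \<times> {0..h}) (\<lambda>p. u (fst p) 0)"
    by (rule continuous_on_compose2[of UNIV "\<lambda>x. u x 0"])
      (auto intro!: continuous_intros continuous_at_imp_continuous_on DERIV_isCont[OF f])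
  have 1: "u x h - u x 0 - b * h \<le> 0"
  proof (rule parabolic_maximum_principle[where w="\<lambda>x t. u x t - u x 0 - b * t" and wt="\<lambda>x t. ut x t - b"
        and wx="\<lambda>x t. ux x t - f' x" and wxx="\<lambda>x t. uxx x t - f'' x" and T=h and \<Lambda>="su\<^sup>2 / 2"])
    show "continuous_on (UNIV \<times> {0..h}) (\<lambda>(x, t). u x t - u x 0 - b * t)"
      unfolding case_prod_beta
      by (intro continuous_intros cont0 continuous_on_subset[OF cont[unfolded case_prod_beta]]) auto
    show "u x t - u x 0 - b * t \<le> 2 * B" if "0 \<le> t" for x t
      using B[OF that, of x] B[of 0 x] mult_nonneg_nonneg[OF b that] by auto
    show "ut x s - b \<le> su\<^sup>2 / 2 * max (uxx x s - f'' x) 0" if "0 < s" for x s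
    proof (cases "f'' x \<le> uxx x s")
      case True
      with G_fun_diff_bounds(2)[OF sl_pos sl_le_su True] eq that K2[of x] show ?thesis
        by (auto simp: b_def)
    next
      case False
      then have "uxx x s \<le> f'' x" by simp
      with G_fun_mono[OF sl_pos sl_le_su this] eq that K2[of x] show ?thesis by (auto simp: b_def)
    qed
  qed (use \<open>0 \<le> h\<close> in \<open>auto intro!: derivative_eq_intros dt dx dxx f f'\<close>)
  have 2: "u x 0 - u x h - b * h \<le> 0"
  proof (rule parabolic_maximum_principle[where w="\<lambda>x t. u x 0 - u x t - b * t" and wt="\<lambda>x t. - ut x t - b"
        and wx="\<lambda>x t. f' x - ux x t" and wxx="\<lambda>x t. f'' x - uxx x t" and T=h and \<Lambda>="su\<^sup>2 / 2"])
    show "continuous_on (UNIV \<times> {0..h}) (\<lambda>(x, t). u x 0 - u x t - b * t)"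
      unfolding case_prod_beta
      by (intro continuous_intros cont0 continuous_on_subset[OF cont[unfolded case_prod_beta]]) auto
    show "u x 0 - u x t - b * t \<le> 2 * B" if "0 \<le> t" for x t
      using B[OF that, of x] B[of 0 x] mult_nonneg_nonneg[OF b that] by auto
    show "- ut x s - b \<le> su\<^sup>2 / 2 * max (f'' x - uxx x s) 0" if "0 < s" for x s
    proof (cases "uxx x s \<le> f'' x")
      case True
      with G_fun_diff_bounds(2)[OF sl_pos sl_le_su True] eq that K2[of x] show ?thesis
        by (auto simp: b_def)
    next
      case False
      then have "f'' x \<le> uxx x s" by simp
      with G_fun_mono[OF sl_pos sl_le_su this] eq that K2[of x] show ?thesis by (auto simp: b_def)
    qed
  qed (use \<open>0 \<le> h\<close> in \<open>auto intro!: derivative_eq_intros dt dx dxx f f'\<close>)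
  from 1 2 show ?thesis unfolding b_def by linarith
qed

lemma right_quotient_tendsto:
  assumes "0 < t"
  shows "((\<lambda>h. (u x (t + h) - u x t) / h) \<longlongrightarrow> ut x t) (at_right 0)"
  using dt[OF assms, of x] by (auto simp: DERIV_def intro: filterlim_mono at_le)

lemma ut_abs_le_of_smooth_initial:
  assumes f: "\<And>x. ((\<lambda>x. u x 0) has_real_derivative f' x) (at x)"
    and f': "\<And>x. (f' has_real_derivative f'' x) (at x)"
    and K: "\<And>x. \<bar>f'' x\<bar> \<le> K" and "0 < t"
  shows "\<bar>ut x t\<bar> \<le> su\<^sup>2 / 2 * K"
proof -
  have *: "\<bar>(u x (t + h) - u x t) / h\<bar> \<le> su\<^sup>2 / 2 * K" if "0 < h" for h
  proof -
    have "\<bar>u x (t + h) - u x t\<bar> \<le> su\<^sup>2 / 2 * K * h"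
      by (rule time_diff_preserved[of 0])
        (use initial_time_diff[OF f f' K] \<open>0 < t\<close> that in auto)
    with that show ?thesis by (simp add: field_simps)
  qed
  have "((\<lambda>h. \<bar>(u x (t + h) - u x t) / h\<bar>) \<longlongrightarrow> \<bar>ut x t\<bar>) (at_right 0)"
    by (rule tendsto_rabs[OF right_quotient_tendsto[OF \<open>0 < t\<close>]])
  then show ?thesis
    by (rule tendsto_upperbound) (use * in \<open>auto intro: eventually_mono[OF eventually_at_right_less]\<close>)
qed

end

section \<open>Regularity of the G-heat flow\<close>

text \<open>Apply the mean value theorem to \<open>f (y + r) - f y\<close> and then to
  \<open>f'\<close>. This serves twice: it links second differences of the flow to
  \<open>uxx\<close>, and it shows that the smoothing of a test function takes values of that
  function.\<close>

lemma second_difference_mean_value: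
  fixes f f' f'' :: "real \<Rightarrow> real"
  assumes f: "\<And>x. (f has_real_derivative f' x) (at x)"
    and f': "\<And>x. (f' has_real_derivative f'' x) (at x)"
    and "0 < r"
  shows "\<exists>\<xi>. \<bar>\<xi> - x\<bar> \<le> r \<and> f (x + r) - 2 * f x + f (x - r) = r\<^sup>2 * f'' \<xi>"
proof -
  have "((\<lambda>y. f (y + r) - f y) has_real_derivative f' (y + r) - f' y) (at y)" for y
    using DERIV_shift[of f "f' (y + r)" y r] f by (auto intro!: DERIV_diff)
  then obtain \<eta> where \<eta>: "x - r < \<eta>" "\<eta> < x"
    "f (x + r) - f x - (f (x - r + r) - f (x - r)) = (x - (x - r)) * (f' (\<eta> + r) - f' \<eta>)"
    using MVT2[of "x - r" x "\<lambda>y. f (y + r) - f y" "\<lambda>y. f' (y + r) - f' y"] \<open>0 < r\<close> by auto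
  obtain \<xi> where \<xi>: "\<eta> < \<xi>" "\<xi> < \<eta> + r" "f' (\<eta> + r) - f' \<eta> = (\<eta> + r - \<eta>) * f'' \<xi>"
    using MVT2[of \<eta> "\<eta> + r" f' f''] f' \<open>0 < r\<close> by auto
  have "f (x + r) - 2 * f x + f (x - r) = r\<^sup>2 * f'' \<xi>"
    using \<eta>(3) \<xi>(3) by (simp add: power2_eq_square)
  moreover have "\<bar>\<xi> - x\<bar> \<le> r" using \<eta> \<xi> by auto
  ultimately show ?thesis by blast
qed

text \<open>If \<open>\<bar>f' x\<bar> = m\<close>, then \<open>\<bar>f'\<bar> \<ge> m / 2\<close>
  on an interval of length \<open>m / (2 * H)\<close>, over which \<open>f\<close> changes by at
  least m^2/(4H). A function bounded by 1 changes by at most 2.\<close>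

lemma landau_inequality:
  fixes f f' :: "real \<Rightarrow> real"
  assumes f: "\<And>x. (f has_real_derivative f' x) (at x)"
    and bdd: "\<And>x. \<bar>f x\<bar> \<le> 1"
    and lip: "\<And>x y. \<bar>f' x - f' y\<bar> \<le> H * \<bar>x - y\<bar>"
    and "0 < H"
  shows "(f' x)\<^sup>2 \<le> 8 * H"
proof (cases "f' x = 0")
  case True
  then show ?thesis using \<open>0 < H\<close> by simp
next
  case False
  define m where "m = \<bar>f' x\<bar>"
  define r where "r = m / (2 * H)"
  have "m > 0" using False by (simp add: m_def)
  then have "r > 0" using \<open>0 < H\<close> by (simp add: r_def)
  obtain \<xi> where \<xi>: "x < \<xi>" "\<xi> < x + r" "f (x + r) - f x = (x + r - x) * f' \<xi>"
    using MVT2[of x "x + r" f f'] f \<open>r > 0\<close> by auto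
  have "\<bar>f' \<xi> - f' x\<bar> \<le> H * \<bar>\<xi> - x\<bar>" by (rule lip)
  also have "\<dots> \<le> H * r" using \<xi> \<open>0 < H\<close> by (intro mult_left_mono) auto
  also have "H * r = m / 2" using \<open>0 < H\<close> by (simp add: r_def)
  finally have "m / 2 \<le> \<bar>f' \<xi>\<bar>" unfolding m_def by linarith
  then have "r * (m / 2) \<le> r * \<bar>f' \<xi>\<bar>" using \<open>r > 0\<close> by (intro mult_left_mono) auto
  also have "\<dots> = \<bar>f (x + r) - f x\<bar>" using \<xi>(3) \<open>r > 0\<close> by (simp add: abs_mult)
  also have "\<dots> \<le> 2" using bdd[of x] bdd[of "x + r"] by linarith
  finally have "m\<^sup>2 \<le> 8 * H" using \<open>0 < H\<close> by (simp add: r_def power2_eq_square field_simps)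
  then show ?thesis by (simp add: m_def)
qed

text \<open>The factor \<open>4 * (1 + 1 / (2 * l))\<close> of the doubling estimate with
  \<open>l = sl\<^sup>2 / 2\<close>.\<close>

definition doubling_const :: "real \<Rightarrow> real" where
  "doubling_const sl = 4 * (1 + 1 / sl\<^sup>2)"

text \<open>The product of (su^2/2)^2 from the upper slope of \<open>G\<close>, 8 from Landau's
  inequality, 2/sl^2 from the inverse of \<open>G\<close>, and twice
  \<open>doubling_const sl\<close>.\<close>

definition ut_const :: "real \<Rightarrow> real \<Rightarrow> real" where
  "ut_const sl su = 8 * su ^ 4 * doubling_const sl / sl\<^sup>2"

definition ut_lip_const :: "real \<Rightarrow> real \<Rightarrow> real" where
  "ut_lip_const sl su = 2 * doubling_const sl * ut_const sl su"

context G_heat_flow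
begin

lemma consts_pos:
  "0 < doubling_const sl" "0 < ut_const sl su" "0 < ut_lip_const sl su"
  using sl_pos su_pos
  by (auto simp: doubling_const_def ut_const_def ut_lip_const_def intro!: divide_pos_pos mult_pos_pos add_pos_pos)

lemma uxx_abs_le: "0 < t \<Longrightarrow> \<bar>uxx x t\<bar> \<le> 2 / sl\<^sup>2 * \<bar>ut x t\<bar>"
  using G_fun_abs_bounds(1)[OF sl_pos sl_le_su, of "uxx x t" 0] eq[of t x] sl_pos
  by (simp add: field_simps)

lemma uxx_diff_le: "0 < t \<Longrightarrow> \<bar>uxx x t - uxx y t\<bar> \<le> 2 / sl\<^sup>2 * \<bar>ut x t - ut y t\<bar>"
  using G_fun_abs_bounds(1)[OF sl_pos sl_le_su, of "uxx x t" "uxx y t"] eq[of t] sl_pos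
  by (simp add: field_simps)

lemma time_mean_value:
  assumes "0 < t" "0 < h"
  shows "\<exists>z. t < z \<and> z < t + h \<and> u x (t + h) - u x t = h * ut x z"
proof -
  have "(u x has_real_derivative ut x s) (at s)" if "t \<le> s" for s
    using dt that assms by simp
  then show ?thesis using MVT2[of t "t + h" "u x" "ut x"] assms by auto
qed

text \<open>The increment is the difference of two time translates of the flow. The lower slope of
  \<open>G\<close> gives exactly the sign conditions of the doubling lemma with
  \<open>l = sl\<^sup>2 / 2\<close>, without naming the coefficient.\<close>

lemma time_increment_lipschitz:
  assumes "0 < s" "0 < h" "0 < \<tau>" "0 < B"
    and B: "\<And>x t. s \<le> t \<Longrightarrow> t \<le> s + \<tau> \<Longrightarrow> \<bar>u x (t + h) - u x t\<bar> \<le> B"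
  shows "\<bar>(u x (s + \<tau> + h) - u x (s + \<tau>)) - (u y (s + \<tau> + h) - u y (s + \<tau>))\<bar>
    \<le> doubling_const sl * B * \<bar>x - y\<bar> / sqrt \<tau>"
proof -
  interpret p: G_heat_flow sl su "\<lambda>x t. u (x + 0) (t + (s + h))" "\<lambda>x t. ut (x + 0) (t + (s + h))"
    "\<lambda>x t. ux (x + 0) (t + (s + h))" "\<lambda>x t. uxx (x + 0) (t + (s + h))"
    by (rule translate) (use assms in auto)
  interpret q: G_heat_flow sl su "\<lambda>x t. u (x + 0) (t + s)" "\<lambda>x t. ut (x + 0) (t + s)"
    "\<lambda>x t. ux (x + 0) (t + s)" "\<lambda>x t. uxx (x + 0) (t + s)"
    by (rule translate) (use assms in auto)
  define w where "w = (\<lambda>x t. u (x + 0) (t + (s + h)) - u (x + 0) (t + s))"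
  have "\<bar>w x \<tau> - w y \<tau>\<bar> \<le> 4 * (1 + 1 / (2 * (sl\<^sup>2 / 2))) * B * \<bar>x - y\<bar> / sqrt \<tau>"
  proof (rule doubling_lipschitz[where
        wt="\<lambda>x t. ut (x + 0) (t + (s + h)) - ut (x + 0) (t + s)" and
        wx="\<lambda>x t. ux (x + 0) (t + (s + h)) - ux (x + 0) (t + s)" and
        wxx="\<lambda>x t. uxx (x + 0) (t + (s + h)) - uxx (x + 0) (t + s)"])
    show "continuous_on (UNIV \<times> {0..\<tau>}) (\<lambda>(x, t). w x t)"
      using p.cont q.cont unfolding case_prod_beta w_def
      by (intro continuous_on_diff) (auto elim: continuous_on_subset)
    show "\<bar>w x t\<bar> \<le> B" if "0 \<le> t" "t \<le> \<tau>" for x t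
      using B[of "t + s" x] that by (simp add: w_def add_ac)
    fix x t :: real assume t: "0 < t" "t \<le> \<tau>"
    let ?p = "uxx (x + 0) (t + (s + h))" and ?q = "uxx (x + 0) (t + s)"
    have e: "ut (x + 0) (t + (s + h)) - ut (x + 0) (t + s) = G_fun sl su ?p - G_fun sl su ?q"
      using p.eq q.eq t by simp
    show "ut (x + 0) (t + (s + h)) - ut (x + 0) (t + s) \<le> sl\<^sup>2 / 2 * (?p - ?q)" if "?p - ?q \<le> 0"
    proof -
      have "?p \<le> ?q" using that by simp
      from G_fun_diff_bounds(1)[OF sl_pos sl_le_su this] show ?thesis
        unfolding e by (simp add: algebra_simps)
    qed
    show "sl\<^sup>2 / 2 * (?p - ?q) \<le> ut (x + 0) (t + (s + h)) - ut (x + 0) (t + s)" if "0 \<le> ?p - ?q"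
    proof -
      have "?q \<le> ?p" using that by simp
      from G_fun_diff_bounds(1)[OF sl_pos sl_le_su this] show ?thesis unfolding e .
    qed
  qed (use assms sl_pos in \<open>auto simp: w_def intro!: DERIV_diff p.dt[simplified] p.dx[simplified]
      p.dxx[simplified] q.dt[simplified] q.dx[simplified] q.dxx[simplified]\<close>)
  then show ?thesis by (simp add: w_def doubling_const_def add_ac)
qed

text \<open>Increments are divided by \<open>h\<close>, and \<open>h\<close> tends to 0 from the
  right. An increment starting at \<open>s + \<tau>\<close> looks ahead by \<open>h\<close>, which
  is why \<open>ut\<close> is bounded up to a horizon \<open>T\<close> beyond
  \<open>s + \<tau>\<close>.\<close>

lemma ut_lipschitz:
  assumes "0 < s" "0 < \<tau>" "0 < B" "s + \<tau> < T"
    and B: "\<And>x t. s \<le> t \<Longrightarrow> t < T \<Longrightarrow> \<bar>ut x t\<bar> \<le> B"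
  shows "\<bar>ut x (s + \<tau>) - ut y (s + \<tau>)\<bar> \<le> doubling_const sl * B * \<bar>x - y\<bar> / sqrt \<tau>"
proof -
  let ?q = "\<lambda>x h. (u x (s + \<tau> + h) - u x (s + \<tau>)) / h"
  have *: "\<bar>?q x h - ?q y h\<bar> \<le> doubling_const sl * B * \<bar>x - y\<bar> / sqrt \<tau>"
    if h: "0 < h" "h < T - (s + \<tau>)" for h
  proof -
    have "\<bar>u x (t + h) - u x t\<bar> \<le> B * h" if "s \<le> t" "t \<le> s + \<tau>" for x t
    proof -
      obtain z where z: "t < z" "z < t + h" "u x (t + h) - u x t = h * ut x z"
        using time_mean_value[of t h x] \<open>s \<le> t\<close> \<open>0 < s\<close> h(1) by auto
      have "\<bar>ut x z\<bar> \<le> B" using B[of z x] z that h by auto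
      then have "h * \<bar>ut x z\<bar> \<le> h * B" using h(1) by (intro mult_left_mono) auto
      then show ?thesis using z(3) h(1) by (simp add: abs_mult mult.commute)
    qed
    then have "\<bar>(u x (s + \<tau> + h) - u x (s + \<tau>)) - (u y (s + \<tau> + h) - u y (s + \<tau>))\<bar>
      \<le> doubling_const sl * (B * h) * \<bar>x - y\<bar> / sqrt \<tau>"
      by (intro time_increment_lipschitz) (use assms h in auto)
    then have "\<bar>(u x (s + \<tau> + h) - u x (s + \<tau>)) - (u y (s + \<tau> + h) - u y (s + \<tau>))\<bar> / h
      \<le> doubling_const sl * (B * h) * \<bar>x - y\<bar> / sqrt \<tau> / h"
      using h(1) by (intro divide_right_mono) auto
    then show ?thesis using h(1) by (simp add: diff_divide_distrib[symmetric])
  qed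
  have "((\<lambda>h. \<bar>?q x h - ?q y h\<bar>) \<longlongrightarrow> \<bar>ut x (s + \<tau>) - ut y (s + \<tau>)\<bar>) (at_right 0)"
    using assms by (intro tendsto_intros right_quotient_tendsto) auto
  moreover have "\<forall>\<^sub>F h in at_right 0. \<bar>?q x h - ?q y h\<bar> \<le> doubling_const sl * B * \<bar>x - y\<bar> / sqrt \<tau>"
    using * assms by (intro eventually_at_rightI[of 0 "T - (s + \<tau>)"]) auto
  ultimately show ?thesis by (rule tendsto_upperbound) simp
qed

end

text \<open>
  The bound \<open>K\<close> makes the supremum \<open>A\<close> of \<open>sqrt t * \<bar>ut x t\<bar>\<close> finite, but does not enter the
  estimates: doubling bounds the Lipschitz constant of \<open>uxx\<close> by a multiple of \<open>A / t\<close>, and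
  Landau's inequality then gives \<open>A\<^sup>2 \<le> ut_const sl su * A\<close>.
\<close>

locale regular_G_heat_flow = G_heat_flow +
  fixes K :: real
  assumes initial_lipschitz: "\<bar>u x 0 - u y 0\<bar> \<le> \<bar>x - y\<bar>"
    and ut_finite: "0 < t \<Longrightarrow> \<bar>ut x t\<bar> \<le> K"
begin

lemma u_lipschitz: "0 \<le> t \<Longrightarrow> \<bar>u x t - u y t\<bar> \<le> \<bar>x - y\<bar>"
  using lipschitz_preserved[of 1 t x y] initial_lipschitz by simp

lemma ux_abs_le:
  assumes "0 < t"
  shows "\<bar>ux x t\<bar> \<le> 1"
proof -
  have "((\<lambda>h. (u (x + h) t - u x t) / h) \<longlongrightarrow> ux x t) (at 0)"
    using dx[OF assms, of x] by (simp add: DERIV_def)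
  then have "((\<lambda>h. \<bar>(u (x + h) t - u x t) / h\<bar>) \<longlongrightarrow> \<bar>ux x t\<bar>) (at 0)"
    by (rule tendsto_rabs)
  moreover have "\<forall>\<^sub>F h in at 0. \<bar>(u (x + h) t - u x t) / h\<bar> \<le> 1"
  proof (rule eventually_mono[OF eventually_neq_at_within])
    fix h :: real assume "h \<noteq> 0"
    then show "\<bar>(u (x + h) t - u x t) / h\<bar> \<le> 1"
      using u_lipschitz[of t "x + h" x] assms by (simp add: field_simps)
  qed
  ultimately show ?thesis by (rule tendsto_upperbound) simp
qed

text \<open>The horizon 2 leaves a margin beyond 1, the last time that the random walk uses, because
  \<open>ut_lipschitz\<close> looks ahead.\<close>

lemma ut_estimates:
  assumes "0 < t" "t < 2"
  shows ut_le: "\<bar>ut x t\<bar> \<le> ut_const sl su / sqrt t"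
    and ut_lip: "\<bar>ut x t - ut y t\<bar> \<le> ut_lip_const sl su / t * \<bar>x - y\<bar>"
proof -
  define S where "S = {sqrt t * \<bar>ut x t\<bar> | x t. 0 < t \<and> t < 2}"
  define A where "A = Sup S"
  define c where "c = doubling_const sl"
  define D where "D = ut_const sl su"
  have c: "c > 0" "D > 0" using consts_pos by (auto simp: c_def D_def)
  have D: "D = 8 * su ^ 4 * c / sl\<^sup>2" by (simp add: D_def c_def ut_const_def)
  have bS: "bdd_above S"
  proof (rule bdd_aboveI)
    fix a assume "a \<in> S"
    then obtain x t where "a = sqrt t * \<bar>ut x t\<bar>" "0 < t" "t < 2" by (auto simp: S_def)
    then show "a \<le> sqrt 2 * K" using ut_finite[of t x] by (auto intro!: mult_mono)
  qed
  have inS: "sqrt t * \<bar>ut x t\<bar> \<in> S" if "0 < t" "t < 2" for x t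
    using that by (auto simp: S_def)
  have neS: "S \<noteq> {}" using inS[of 1 0] by auto
  have leA: "sqrt t * \<bar>ut x t\<bar> \<le> A" if "0 < t" "t < 2" for x t
    unfolding A_def by (rule cSup_upper[OF inS[OF that] bS])
  \<comment> \<open>Doubling runs over the second half of \<open>[0, t]\<close>, where
    \<open>\<bar>ut\<bar>\<close> is at most \<open>a / sqrt (t / 2)\<close>. The bound
    \<open>a\<close> is kept variable: it must be positive while \<open>A\<close> may vanish, and it
    is taken to be \<open>A\<close> in the proof of \<open>A \<le> D\<close> and \<open>D\<close> at
    the end.\<close>
  have lip: "\<bar>ut x t - ut y t\<bar> \<le> 2 * c * a / t * \<bar>x - y\<bar>"
    if t: "0 < t" "t < 2" and a: "A \<le> a" "0 < a" for a t x y
  proof -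
    have "\<bar>ut x (t / 2 + t / 2) - ut y (t / 2 + t / 2)\<bar>
      \<le> doubling_const sl * (a / sqrt (t / 2)) * \<bar>x - y\<bar> / sqrt (t / 2)"
    proof (rule ut_lipschitz[where T=2])
      fix x s assume s: "t / 2 \<le> s" "s < 2"
      have "sqrt (t / 2) * \<bar>ut x s\<bar> \<le> sqrt s * \<bar>ut x s\<bar>" using s by (intro mult_right_mono) auto
      also have "\<dots> \<le> a" using leA[of s x] s t a by simp
      finally show "\<bar>ut x s\<bar> \<le> a / sqrt (t / 2)" using t by (simp add: field_simps)
    qed (use t a in auto)
    also have "\<dots> = doubling_const sl * a * \<bar>x - y\<bar> / (sqrt (t / 2) * sqrt (t / 2))" by simp
    also have "\<dots> = doubling_const sl * a * \<bar>x - y\<bar> / (t / 2)" using t by simp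
    finally show ?thesis by (simp add: c_def mult_ac)
  qed
  have key: "A \<le> sqrt (D * a)" if a: "A \<le> a" "0 < a" for a
    unfolding A_def
  proof (rule cSup_least[OF neS])
    fix b assume "b \<in> S"
    then obtain x t where b: "b = sqrt t * \<bar>ut x t\<bar>" "0 < t" "t < 2" by (auto simp: S_def)
    define H where "H = 2 / sl\<^sup>2 * (2 * c * a / t)"
    have "H > 0" using c a b sl_pos by (simp add: H_def)
    have "(uxx x t)\<^sup>2 \<le> 8 * H"
    proof (rule landau_inequality[where f="\<lambda>y. ux y t" and f'="\<lambda>y. uxx y t"])
      show "\<bar>uxx x t - uxx y t\<bar> \<le> H * \<bar>x - y\<bar>" for x y
      proof -
        have "\<bar>uxx x t - uxx y t\<bar> \<le> 2 / sl\<^sup>2 * \<bar>ut x t - ut y t\<bar>" by (rule uxx_diff_le[OF b(2)])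
        also have "\<dots> \<le> 2 / sl\<^sup>2 * (2 * c * a / t * \<bar>x - y\<bar>)"
          by (intro mult_left_mono lip[OF b(2,3) a]) auto
        finally show ?thesis by (simp add: H_def mult_ac)
      qed
    qed (use dxx ux_abs_le b \<open>H > 0\<close> in auto)
    then have le: "(su\<^sup>2 / 2)\<^sup>2 * (uxx x t)\<^sup>2 \<le> (su\<^sup>2 / 2)\<^sup>2 * (8 * H)"
      by (intro mult_left_mono) auto
    have "\<bar>ut x t\<bar> \<le> su\<^sup>2 / 2 * \<bar>uxx x t\<bar>"
      using G_fun_abs_bounds(2)[OF sl_pos sl_le_su, of "uxx x t" 0] eq[OF b(2)] by simp
    then have "\<bar>ut x t\<bar>\<^sup>2 \<le> (su\<^sup>2 / 2 * \<bar>uxx x t\<bar>)\<^sup>2"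
      by (rule power_mono) simp
    also have "\<dots> = (su\<^sup>2 / 2)\<^sup>2 * (uxx x t)\<^sup>2"
      unfolding power_mult_distrib[of "su\<^sup>2 / 2"] by simp
    also note le
    finally have "t * (ut x t)\<^sup>2 \<le> t * ((su\<^sup>2 / 2)\<^sup>2 * (8 * H))" using b by simp
    also have "\<dots> = ((su\<^sup>2 / 2)\<^sup>2 * 32 / sl\<^sup>2) * (c * a * (t / t))" by (simp add: H_def)
    also have "(su\<^sup>2 / 2)\<^sup>2 * 32 = 8 * su ^ 4" by (simp add: power_divide power_mult[symmetric])
    also have "(8 * su ^ 4 / sl\<^sup>2) * (c * a * (t / t)) = D * a" using b by (simp add: D)
    finally have "b\<^sup>2 \<le> D * a" using b by (simp add: power_mult_distrib)
    then show "b \<le> sqrt (D * a)" by (rule real_le_rsqrt)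
  qed
  have "A \<le> D"
  proof (rule ccontr)
    assume "\<not> A \<le> D"
    then have "A > D" by simp
    then have "A > 0" using c by simp
    then have "A\<^sup>2 \<le> (sqrt (D * A))\<^sup>2" using key[of A] by (intro power_mono) auto
    then have "A * A \<le> D * A" using c \<open>A > 0\<close> by (simp add: power2_eq_square)
    with \<open>A > D\<close> \<open>A > 0\<close> show False by simp
  qed
  show "\<bar>ut x t\<bar> \<le> ut_const sl su / sqrt t"
    using leA[OF assms, of x] \<open>A \<le> D\<close> assms by (simp add: D_def field_simps)
  show "\<bar>ut x t - ut y t\<bar> \<le> ut_lip_const sl su / t * \<bar>x - y\<bar>"
    using lip[OF assms \<open>A \<le> D\<close> c(2), of x y] by (simp add: ut_lip_const_def c_def D_def)
qed

lemma uxx_le: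
  assumes "0 < t" "t < 2"
  shows "\<bar>uxx x t\<bar> \<le> 2 / sl\<^sup>2 * ut_const sl su / sqrt t"
proof -
  have "\<bar>uxx x t\<bar> \<le> 2 / sl\<^sup>2 * \<bar>ut x t\<bar>" by (rule uxx_abs_le[OF assms(1)])
  also have "\<dots> \<le> 2 / sl\<^sup>2 * (ut_const sl su / sqrt t)" by (intro mult_left_mono ut_le[OF assms]) auto
  finally show ?thesis by simp
qed

lemma uxx_lip:
  assumes "0 < t" "t < 2"
  shows "\<bar>uxx x t - uxx y t\<bar> \<le> 2 / sl\<^sup>2 * ut_lip_const sl su / t * \<bar>x - y\<bar>"
proof -
  have "\<bar>uxx x t - uxx y t\<bar> \<le> 2 / sl\<^sup>2 * \<bar>ut x t - ut y t\<bar>" by (rule uxx_diff_le[OF assms(1)])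
  also have "\<dots> \<le> 2 / sl\<^sup>2 * (ut_lip_const sl su / t * \<bar>x - y\<bar>)"
    by (intro mult_left_mono ut_lip[OF assms]) auto
  finally show ?thesis by simp
qed

text \<open>\<open>2 * D * sqrt s\<close> has derivative \<open>D / sqrt s\<close>, which dominates
  \<open>\<bar>ut x s\<bar>\<close> for \<open>D = ut_const sl su\<close>. Monotonicity of the two
  differences replaces integration of the singular bound.\<close>

lemma initial_layer:
  assumes "0 \<le> t" "t < 2"
  shows "\<bar>u x t - u x 0\<bar> \<le> 2 * ut_const sl su * sqrt t"
proof -
  let ?D = "ut_const sl su"
  have cu: "continuous_on {0..t} (u x)"
    by (rule continuous_on_compose2[OF cont, of _ "\<lambda>s. (x, s)", simplified])
      (auto intro!: continuous_intros)
  have "u x t - 2 * ?D * sqrt t \<le> u x 0 - 2 * ?D * sqrt 0"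
  proof (rule DERIV_nonpos_imp_decreasing_open[OF assms(1)])
    fix s assume s: "0 < s" "s < t"
    have "((\<lambda>s. u x s - 2 * ?D * sqrt s) has_real_derivative ut x s - ?D / sqrt s) (at s)"
      using s by (auto intro!: derivative_eq_intros dt simp: field_simps)
    moreover have "ut x s - ?D / sqrt s \<le> 0" using ut_le[of s x] s assms by auto
    ultimately show "\<exists>y. ((\<lambda>s. u x s - 2 * ?D * sqrt s) has_real_derivative y) (at s) \<and> y \<le> 0"
      by blast
  qed (intro continuous_intros cu)
  moreover have "- u x t - 2 * ?D * sqrt t \<le> - u x 0 - 2 * ?D * sqrt 0"
  proof (rule DERIV_nonpos_imp_decreasing_open[OF assms(1)])
    fix s assume s: "0 < s" "s < t"
    have "((\<lambda>s. - u x s - 2 * ?D * sqrt s) has_real_derivative - ut x s - ?D / sqrt s) (at s)"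
      using s by (auto intro!: derivative_eq_intros dt simp: field_simps)
    moreover have "- ut x s - ?D / sqrt s \<le> 0" using ut_le[of s x] s assms by auto
    ultimately show "\<exists>y. ((\<lambda>s. - u x s - 2 * ?D * sqrt s) has_real_derivative y) (at s) \<and> y \<le> 0"
      by blast
  qed (intro continuous_intros cu)
  ultimately show ?thesis by (simp add: abs_le_iff)
qed

text \<open>
  Regularity of \<open>uxx\<close> in time comes from that in space: the second difference of \<open>u\<close> with step
  \<open>sqrt h\<close> approximates \<open>h * uxx\<close>, and its time derivative is controlled by the Lipschitz constant
  of \<open>ut\<close> in space.
\<close>

lemma time_step:
  assumes "0 < t" "0 < h" "t + h < 2"
  shows "\<bar>u x (t + h) - u x t - h * G_fun sl su (uxx x t)\<bar>
    \<le> su\<^sup>2 * (1 + 2 / sl\<^sup>2) * ut_lip_const sl su * (h * sqrt h / t)"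
proof -
  define L where "L = ut_lip_const sl su / t"
  define H where "H = 2 / sl\<^sup>2 * L"
  \<comment> \<open>A second difference with step \<open>r\<close>, divided by
    \<open>r\<^sup>2\<close>, differs from \<open>uxx\<close> by order \<open>H * r\<close> and
    changes over time \<open>h\<close> by order \<open>L * h / r\<close>. The choice
    \<open>r = sqrt h\<close> balances the two.\<close>
  define r where "r = sqrt h"
  have r: "r > 0" "r\<^sup>2 = h" using assms by (auto simp: r_def)
  have "L > 0" using consts_pos assms by (simp add: L_def)
  then have "H > 0" using sl_pos by (simp add: H_def)
  have L: "\<bar>ut x s - ut y s\<bar> \<le> L * \<bar>x - y\<bar>" if "t \<le> s" "s \<le> t + h" for x y s
  proof -
    have "\<bar>ut x s - ut y s\<bar> \<le> ut_lip_const sl su / s * \<bar>x - y\<bar>" using that assms by (intro ut_lip) auto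
    also have "\<dots> \<le> L * \<bar>x - y\<bar>"
      unfolding L_def using that assms consts_pos by (intro mult_right_mono divide_left_mono) auto
    finally show ?thesis .
  qed
  have H: "\<bar>uxx x s - uxx y s\<bar> \<le> H * \<bar>x - y\<bar>" if "t \<le> s" "s \<le> t + h" for x y s
  proof -
    have "\<bar>uxx x s - uxx y s\<bar> \<le> 2 / sl\<^sup>2 * \<bar>ut x s - ut y s\<bar>" using that assms by (intro uxx_diff_le) auto
    also have "\<dots> \<le> 2 / sl\<^sup>2 * (L * \<bar>x - y\<bar>)" by (intro mult_left_mono L that) auto
    finally show ?thesis by (simp add: H_def)
  qed
  define \<Delta> where "\<Delta> = (\<lambda>s. u (x + r) s - 2 * u x s + u (x - r) s)"
  have \<Delta>: "\<bar>\<Delta> s - h * uxx x s\<bar> \<le> h * (H * r)" if "t \<le> s" "s \<le> t + h" for s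
  proof -
    have "0 < s" using that assms by simp
    then obtain \<xi> where \<xi>: "\<bar>\<xi> - x\<bar> \<le> r" "\<Delta> s = r\<^sup>2 * uxx \<xi> s"
      using second_difference_mean_value[OF dx dxx r(1)] unfolding \<Delta>_def by blast
    have "\<bar>uxx \<xi> s - uxx x s\<bar> \<le> H * \<bar>\<xi> - x\<bar>" by (rule H[OF that])
    also have "\<dots> \<le> H * r" using \<xi> \<open>H > 0\<close> by (intro mult_left_mono) auto
    finally have "h * \<bar>uxx \<xi> s - uxx x s\<bar> \<le> h * (H * r)" using assms by (intro mult_left_mono) auto
    moreover have "\<bar>\<Delta> s - h * uxx x s\<bar> = h * \<bar>uxx \<xi> s - uxx x s\<bar>"
      using \<xi>(2) r assms by (simp add: abs_mult right_diff_distrib[symmetric])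
    ultimately show ?thesis by simp
  qed
  have \<Delta>t: "\<bar>\<Delta> s - \<Delta> t\<bar> \<le> h * (2 * L * r)" if s: "t < s" "s \<le> t + h" for s
  proof -
    have "(\<Delta> has_real_derivative ut (x + r) z - 2 * ut x z + ut (x - r) z) (at z)" if "t \<le> z" for z
      unfolding \<Delta>_def using that assms by (auto intro!: derivative_eq_intros dt)
    then obtain z where z: "t < z" "z < s"
      "\<Delta> s - \<Delta> t = (s - t) * (ut (x + r) z - 2 * ut x z + ut (x - r) z)"
      using MVT2[of t s \<Delta> "\<lambda>z. ut (x + r) z - 2 * ut x z + ut (x - r) z"] s by auto
    have "\<bar>ut (x + r) z - ut x z\<bar> \<le> L * r" "\<bar>ut (x - r) z - ut x z\<bar> \<le> L * r"
      using L[of z "x + r" x] L[of z "x - r" x] z s r by auto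
    then have *: "\<bar>ut (x + r) z - 2 * ut x z + ut (x - r) z\<bar> \<le> 2 * L * r" by linarith
    have "\<bar>\<Delta> s - \<Delta> t\<bar> = (s - t) * \<bar>ut (x + r) z - 2 * ut x z + ut (x - r) z\<bar>"
      using z(3) s by (simp add: abs_mult)
    also have "\<dots> \<le> h * (2 * L * r)" using s assms by (intro mult_mono *) auto
    finally show ?thesis .
  qed
  have uxxt: "\<bar>uxx x s - uxx x t\<bar> \<le> 2 * (H + L) * r" if s: "t < s" "s \<le> t + h" for s
  proof -
    have "\<bar>h * uxx x s - h * uxx x t\<bar> \<le> h * (H * r) + h * (H * r) + h * (2 * L * r)"
    proof -
      have "\<bar>\<Delta> s - h * uxx x s\<bar> \<le> h * (H * r)" "\<bar>\<Delta> t - h * uxx x t\<bar> \<le> h * (H * r)"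
        using \<Delta> s by auto
      with \<Delta>t[OF s] show ?thesis by linarith
    qed
    also have "\<dots> = h * (2 * (H + L) * r)" by (simp add: algebra_simps)
    also have "\<bar>h * uxx x s - h * uxx x t\<bar> = h * \<bar>uxx x s - uxx x t\<bar>"
      using assms by (simp add: abs_mult right_diff_distrib[symmetric])
    finally show ?thesis using assms by simp
  qed
  obtain z where z: "t < z" "z < t + h" "u x (t + h) - u x t = h * ut x z"
    using time_mean_value[of t h x] assms by auto
  have "\<bar>ut x z - G_fun sl su (uxx x t)\<bar> \<le> su\<^sup>2 / 2 * \<bar>uxx x z - uxx x t\<bar>"
    using G_fun_abs_bounds(2)[OF sl_pos sl_le_su] eq z assms by auto
  also have "\<dots> \<le> su\<^sup>2 / 2 * (2 * (H + L) * r)" using z by (intro mult_left_mono uxxt) auto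
  also have "\<dots> = su\<^sup>2 * (1 + 2 / sl\<^sup>2) * ut_lip_const sl su * (r / t)"
    by (simp add: H_def L_def add_divide_distrib algebra_simps)
  finally have "h * \<bar>ut x z - G_fun sl su (uxx x t)\<bar>
      \<le> h * (su\<^sup>2 * (1 + 2 / sl\<^sup>2) * ut_lip_const sl su * (r / t))"
    using assms by (intro mult_left_mono) auto
  moreover have "\<bar>u x (t + h) - u x t - h * G_fun sl su (uxx x t)\<bar> = h * \<bar>ut x z - G_fun sl su (uxx x t)\<bar>"
    using z(3) assms by (simp add: abs_mult right_diff_distrib[symmetric])
  ultimately show ?thesis by (simp add: r_def mult_ac)
qed

end

section \<open>Taylor remainder, smoothing of test functions and interpolation of the bounds on
  \<open>uxx\<close>\<close>

lemma taylor_hoelder: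
  fixes f f' f'' :: "real \<Rightarrow> real"
  assumes f: "\<And>x. (f has_real_derivative f' x) (at x)"
    and f': "\<And>x. (f' has_real_derivative f'' x) (at x)"
    and hoelder: "\<And>x y. \<bar>f'' x - f'' y\<bar> \<le> H * sqrt \<bar>x - y\<bar>"
  shows "\<bar>f (x + y) - f x - f' x * y - f'' x / 2 * y\<^sup>2\<bar> \<le> H / 2 * (y\<^sup>2 * sqrt \<bar>y\<bar>)"
proof (cases "y = 0")
  case False
  define d where "d = (\<lambda>m::nat. if m = 0 then f else if m = 1 then f' else f'')"
  have "0 \<le> H" using hoelder[of 1 0] by simp
  have "\<forall>m t. m < 2 \<and> min x (x + y) \<le> t \<and> t \<le> max x (x + y) \<longrightarrow>
      (d m has_real_derivative d (Suc m) t) (at t)"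
    using f f' by (auto simp: d_def)
  from Taylor[OF _ _ this, of f x "x + y"] False
  obtain t where t: "if x + y < x then x + y < t \<and> t < x else x < t \<and> t < x + y"
    "f (x + y) = (\<Sum>m<2. d m x / fact m * (x + y - x) ^ m) + d 2 t / fact 2 * (x + y - x)\<^sup>2"
    by (auto simp: d_def)
  have "f (x + y) - f x - f' x * y - f'' x / 2 * y\<^sup>2 = (f'' t - f'' x) / 2 * y\<^sup>2"
    using t(2) by (simp add: d_def numeral_2_eq_2 algebra_simps diff_divide_distrib)
  then have "\<bar>f (x + y) - f x - f' x * y - f'' x / 2 * y\<^sup>2\<bar> = \<bar>(f'' t - f'' x) / 2 * y\<^sup>2\<bar>"
    by (rule arg_cong)
  also have "\<dots> = \<bar>f'' t - f'' x\<bar> / 2 * y\<^sup>2"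
    by (simp add: abs_mult)
  also have "\<dots> \<le> (H * sqrt \<bar>y\<bar>) / 2 * y\<^sup>2"
  proof (intro mult_right_mono divide_right_mono)
    have "\<bar>f'' t - f'' x\<bar> \<le> H * sqrt \<bar>t - x\<bar>" by (rule hoelder)
    also have "\<dots> \<le> H * sqrt \<bar>y\<bar>"
      using t(1) \<open>0 \<le> H\<close> by (intro mult_left_mono) (auto split: if_splits)
    finally show "\<bar>f'' t - f'' x\<bar> \<le> H * sqrt \<bar>y\<bar>" .
  qed auto
  finally show ?thesis by (simp add: mult_ac)
qed simp

lemma CbLip_lipschitzI:
  assumes "L-lipschitz_on UNIV f" "\<And>x. \<bar>f x\<bar> \<le> B"
  shows "f \<in> CbLip"
  using assms by (auto simp: CbLip_def bounded_iff)

lemma CbLip_affine: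
  assumes "f \<in> CbLip"
  shows "(\<lambda>y. f (x + s * y)) \<in> CbLip"
proof -
  obtain B L where B: "\<And>x. \<bar>f x\<bar> \<le> B" and L: "L-lipschitz_on UNIV f"
    using assms by (auto simp: CbLip_def bounded_iff)
  have "(L * \<bar>s\<bar>)-lipschitz_on UNIV (\<lambda>y. f (x + s * y))"
  proof (rule lipschitz_onI)
    show "dist (f (x + s * y)) (f (x + s * z)) \<le> L * \<bar>s\<bar> * dist y z" for y z
      using lipschitz_onD[OF L, of "x + s * y" "x + s * z"]
      by (simp add: dist_real_def abs_mult right_diff_distrib[symmetric])
  qed (use lipschitz_on_nonneg[OF L] in simp)
  then show ?thesis using B by (rule CbLip_lipschitzI)
qed

lemma continuous_antiderivative:
  fixes f :: "real \<Rightarrow> real"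
  assumes "continuous_on UNIV f"
  obtains F where "\<And>x. (F has_real_derivative f x) (at x)"
proof -
  have "\<exists>F. \<forall>x. -\<infinity> < ereal x \<longrightarrow> ereal x < \<infinity> \<longrightarrow> (F has_vector_derivative f x) (at x)"
    using assms by (intro einterval_antiderivative) (auto simp: continuous_on_eq_continuous_at)
  then show ?thesis using that by (auto simp: has_real_derivative_iff_has_vector_derivative)
qed

text \<open>\<open>g\<close> is the second difference quotient of a second antiderivative of
  \<open>\<phi>\<close>, that is, the average of \<open>\<phi>\<close> against a triangular kernel
  of half-width \<open>\<epsilon>\<close>. In this form \<open>g''\<close> is explicit, and the mean
  value lemma replaces convolution: each \<open>g x\<close> is a value of \<open>\<phi>\<close>
  within distance \<open>\<epsilon>\<close>, and applied to increments it yields the Lipschitz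
  constant 1.\<close>

lemma smooth_approximation:
  assumes lip: "1-lipschitz_on UNIV \<phi>" and "\<phi> \<in> CbLip" and "0 < \<epsilon>"
  obtains g g' g'' K where "g \<in> CbLip" "1-lipschitz_on UNIV g" "\<And>x. \<bar>g x - \<phi> x\<bar> \<le> \<epsilon>"
    "\<And>x. (g has_real_derivative g' x) (at x)" "\<And>x. (g' has_real_derivative g'' x) (at x)"
    "\<And>x. \<bar>g'' x\<bar> \<le> (K::real)"
proof -
  obtain B where B: "\<And>x. \<bar>\<phi> x\<bar> \<le> B"
    using \<open>\<phi> \<in> CbLip\<close> by (auto simp: CbLip_def bounded_iff)
  have lip': "\<bar>\<phi> x - \<phi> y\<bar> \<le> \<bar>x - y\<bar>" for x y
    using lipschitz_onD[OF lip, of x y] by (simp add: dist_real_def)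
  obtain F where F: "\<And>x. (F has_real_derivative \<phi> x) (at x)"
    using continuous_antiderivative[OF lipschitz_on_continuous_on[OF lip]] by blast
  then have "continuous_on UNIV F"
    by (meson DERIV_isCont continuous_at_imp_continuous_on)
  then obtain F2 where F2: "\<And>x. (F2 has_real_derivative F x) (at x)"
    using continuous_antiderivative by blast
  have sh: "((\<lambda>x. F (x + c)) has_real_derivative \<phi> (x + c)) (at x)"
    "((\<lambda>x. F2 (x + c)) has_real_derivative F (x + c)) (at x)" for c x
    using DERIV_shift[of F _ x c] DERIV_shift[of F2 _ x c] F F2 by auto
  \<comment> \<open>The summands \<open>x + 0\<close> and \<open>x + - \<epsilon>\<close> have the
    shape of the shift rules \<open>sh\<close>.\<close>
  define g where "g = (\<lambda>x. (F2 (x + \<epsilon>) - 2 * F2 (x + 0) + F2 (x + - \<epsilon>)) / \<epsilon>\<^sup>2)"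
  define g' where "g' = (\<lambda>x. (F (x + \<epsilon>) - 2 * F (x + 0) + F (x + - \<epsilon>)) / \<epsilon>\<^sup>2)"
  define g'' where "g'' = (\<lambda>x. (\<phi> (x + \<epsilon>) - 2 * \<phi> (x + 0) + \<phi> (x + - \<epsilon>)) / \<epsilon>\<^sup>2)"
  have mean: "\<exists>\<xi>. \<bar>\<xi> - x\<bar> \<le> \<epsilon> \<and> g x = \<phi> \<xi>" for x
    using second_difference_mean_value[OF F2 F \<open>0 < \<epsilon>\<close>, of x] \<open>0 < \<epsilon>\<close> by (auto simp: g_def)
  have g_lip: "\<bar>g x - g y\<bar> \<le> \<bar>x - y\<bar>" for x y
  proof -
    let ?k = "x - y"
    obtain \<xi> where \<xi>: "(F2 (y + \<epsilon> + ?k) - F2 (y + \<epsilon>)) - 2 * (F2 (y + ?k) - F2 y)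
        + (F2 (y - \<epsilon> + ?k) - F2 (y - \<epsilon>)) = \<epsilon>\<^sup>2 * (\<phi> (\<xi> + ?k) - \<phi> \<xi>)"
      using second_difference_mean_value[of "\<lambda>x. F2 (x + ?k) - F2 x" "\<lambda>x. F (x + ?k) - F x"
        "\<lambda>x. \<phi> (x + ?k) - \<phi> x", OF DERIV_diff[OF sh(2) F2] DERIV_diff[OF sh(1) F] \<open>0 < \<epsilon>\<close>, of y]
      by blast
    have "g x - g y = ((F2 (y + \<epsilon> + ?k) - F2 (y + \<epsilon>)) - 2 * (F2 (y + ?k) - F2 y)
        + (F2 (y - \<epsilon> + ?k) - F2 (y - \<epsilon>))) / \<epsilon>\<^sup>2"
      by (simp add: g_def diff_divide_distrib[symmetric] algebra_simps)
    also have "\<dots> = \<phi> (\<xi> + ?k) - \<phi> \<xi>" unfolding \<xi> using \<open>0 < \<epsilon>\<close> by simp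
    finally show ?thesis using lip'[of "\<xi> + ?k" \<xi>] by simp
  qed
  have 1: "1-lipschitz_on UNIV g"
    using g_lip by (intro lipschitz_onI) (auto simp: dist_real_def)
  have 2: "g \<in> CbLip"
    using mean B by (intro CbLip_lipschitzI[OF 1, of B]) metis
  have 3: "\<bar>g x - \<phi> x\<bar> \<le> \<epsilon>" for x
  proof -
    obtain \<xi> where "\<bar>\<xi> - x\<bar> \<le> \<epsilon>" "g x = \<phi> \<xi>" using mean by blast
    then show ?thesis using lip'[of \<xi> x] by simp
  qed
  have 4: "(g has_real_derivative g' x) (at x)" "(g' has_real_derivative g'' x) (at x)" for x
    unfolding g_def g'_def g''_def by (intro DERIV_cdivide DERIV_add DERIV_diff DERIV_cmult sh)+
  have 5: "\<bar>g'' x\<bar> \<le> 4 * B / \<epsilon>\<^sup>2" for x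
    using B[of "x + \<epsilon>"] B[of "x + 0"] B[of "x + - \<epsilon>"] unfolding g''_def
    by (simp add: divide_right_mono)
  show ?thesis by (rule that[OF 2 1 3 4 5])
qed

definition uxx_hoelder_const :: "real \<Rightarrow> real \<Rightarrow> real" where
  "uxx_hoelder_const sl su = 2 / sl\<^sup>2 * sqrt (2 * ut_const sl su * ut_lip_const sl su)"

text \<open>The difference is bounded both by order t^(-1/2) and by order
  \<open>\<bar>x - y\<bar> / t\<close>, hence by the square root of the product.\<close>

lemma (in regular_G_heat_flow) uxx_hoelder:
  assumes "0 < t" "t < 2"
  shows "\<bar>uxx x t - uxx y t\<bar> \<le> uxx_hoelder_const sl su * t powr (-3/4) * sqrt \<bar>x - y\<bar>"
proof -
  let ?D = "ut_const sl su" and ?L = "ut_lip_const sl su" and ?d = "\<bar>uxx x t - uxx y t\<bar>"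
  have "?d \<le> 2 * (2 / sl\<^sup>2 * ?D / sqrt t)"
    using uxx_le[OF assms, of x] uxx_le[OF assms, of y] by linarith
  then have "?d * ?d \<le> (2 * (2 / sl\<^sup>2 * ?D / sqrt t)) * (2 / sl\<^sup>2 * ?L / t * \<bar>x - y\<bar>)"
    using consts_pos assms by (intro mult_mono uxx_lip[OF assms]) auto
  also have "\<dots> = (2 / sl\<^sup>2)\<^sup>2 * (2 * ?D * ?L) * (1 / (t * sqrt t)) * \<bar>x - y\<bar>"
    by (simp add: power2_eq_square mult_ac)
  also have "1 / (t * sqrt t) = (t powr (-3/4))\<^sup>2"
  proof -
    have "t * sqrt t = t powr (1 + 1 / 2)"
      unfolding powr_add using assms by (simp add: powr_half_sqrt)
    moreover have "(t powr (-3/4))\<^sup>2 = t powr (- (3 / 2))"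
      using assms by (simp add: powr_power)
    ultimately show ?thesis by (simp add: powr_minus_divide)
  qed
  finally have "?d \<le> sqrt ((2 / sl\<^sup>2)\<^sup>2 * (2 * ?D * ?L) * (t powr (-3/4))\<^sup>2 * \<bar>x - y\<bar>)"
    by (intro real_le_rsqrt) (simp add: power2_eq_square)
  also have "\<dots> = uxx_hoelder_const sl su * t powr (-3/4) * sqrt \<bar>x - y\<bar>"
    by (simp add: uxx_hoelder_const_def real_sqrt_mult)
  finally show ?thesis .
qed

text \<open>Induction with \<open>a\<close> and \<open>b\<close> the fourth roots of
  \<open>n + 1\<close> and \<open>n\<close>: 1 = a^4 - b^4 is at most 4 a^3 (a - b), so each summand
  is at most \<open>4 * (a - b)\<close>.\<close>

lemma sum_powr_minus_three_quarters:
  "(\<Sum>j=1..n. real j powr (-3/4)) \<le> 4 * real n powr (1/4)"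
proof (induction n)
  case (Suc n)
  define a where "a = real (Suc n) powr (1/4)"
  define b where "b = real n powr (1/4)"
  have a4: "a ^ 4 = real (Suc n)" unfolding a_def by (simp add: powr_power)
  have b4: "b ^ 4 = real n" unfolding b_def by (cases "n = 0") (auto simp: powr_power)
  have ab: "0 < a" "0 \<le> b" "b \<le> a" by (auto simp: a_def b_def intro!: powr_mono2)
  have le: "a\<^sup>2 * b \<le> a\<^sup>2 * a" "a * b\<^sup>2 \<le> a * a\<^sup>2" "b ^ 3 \<le> a ^ 3"
    using ab by (auto intro!: mult_left_mono power_mono)
  have "1 = (a - b) * (a ^ 3 + a\<^sup>2 * b + a * b\<^sup>2 + b ^ 3)"
    using a4 b4 by (simp add: algebra_simps power2_eq_square power3_eq_cube power4_eq_xxxx)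
  also have "\<dots> \<le> (a - b) * (4 * a ^ 3)"
  proof (intro mult_left_mono)
    have "a\<^sup>2 * a = a ^ 3" "a * a\<^sup>2 = a ^ 3" by (simp_all add: power2_eq_square power3_eq_cube)
    with le show "a ^ 3 + a\<^sup>2 * b + a * b\<^sup>2 + b ^ 3 \<le> 4 * a ^ 3" by linarith
  qed (use ab in simp)
  finally have "1 / a ^ 3 \<le> 4 * (a - b)" using ab by (simp add: field_simps)
  moreover have "real (Suc n) powr (-3/4) = 1 / a ^ 3"
    unfolding a_def by (simp add: powr_power powr_minus_divide del: of_nat_Suc)
  ultimately show ?case using Suc by (simp add: a_def b_def)
qed simp

section \<open>One step of the random walk\<close>

lemma weak_topology_topspace:
  "topspace weak_topology \<subseteq> {M. real_distribution M}"
  unfolding weak_topology_def topology_generated_by_topspace by auto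

text \<open>A compact set lies in the carrier of the topology, and the carrier of
  \<open>weak_topology\<close> contains only real distributions.\<close>

lemma represents_law_real_distribution:
  "represents_law E X \<Theta> \<Longrightarrow> M \<in> \<Theta> \<Longrightarrow> real_distribution M"
  using weak_topology_topspace compactin_subset_topspace
  by (fastforce simp: represents_law_def)

lemma ext_integral_eq:
  assumes "integrable M f"
  shows "ext_integral M f = ereal (LINT x|M. f x)"
proof -
  have "(\<integral>\<^sup>+x. ennreal (f x) \<partial>M) < \<infinity>" "(\<integral>\<^sup>+x. ennreal (- f x) \<partial>M) < \<infinity>"
    using assms by (auto simp: real_integrable_def less_top)
  then show ?thesis
    unfolding ext_integral_def real_lebesgue_integral_def[OF assms]
    by (cases "\<integral>\<^sup>+x. ennreal (f x) \<partial>M"; cases "\<integral>\<^sup>+x. ennreal (- f x) \<partial>M") auto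
qed

lemma ext_integral_nonneg_integrable:
  assumes "f \<in> borel_measurable M" "\<And>x. 0 \<le> f x" "ext_integral M f \<le> ereal c"
  shows "integrable M f"
proof (rule integrableI_nonneg)
  have "enn2ereal (\<integral>\<^sup>+x. ennreal (f x) \<partial>M) \<le> ereal c"
    using assms(2,3) by (simp add: ext_integral_def ennreal_neg zero_ennreal.rep_eq)
  then show "(\<integral>\<^sup>+x. ennreal (f x) \<partial>M) < \<infinity>"
    by (cases "\<integral>\<^sup>+x. ennreal (f x) \<partial>M") auto
qed (use assms in auto)

text \<open>\<open>M5\<close> bounds the moment of order 5/2, which is 2 + \<alpha> for \<alpha> =
  1/2. The extreme variances enter through near-extremal measures, so that nothing depends on their
  being attained.\<close>

locale moment_family =
  fixes \<Theta> :: "real measure set" and sl su M5 :: real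
  assumes nonempty: "\<Theta> \<noteq> {}"
    and distr: "M \<in> \<Theta> \<Longrightarrow> real_distribution M"
    and su_pos: "0 < su"
    and int1: "M \<in> \<Theta> \<Longrightarrow> integrable M (\<lambda>x. x)"
    and mean0: "M \<in> \<Theta> \<Longrightarrow> (LINT x|M. x) = 0"
    and int2: "M \<in> \<Theta> \<Longrightarrow> integrable M (\<lambda>x. x\<^sup>2)"
    and var_le: "M \<in> \<Theta> \<Longrightarrow> (LINT x|M. x\<^sup>2) \<le> su\<^sup>2"
    and var_ge: "M \<in> \<Theta> \<Longrightarrow> sl\<^sup>2 \<le> (LINT x|M. x\<^sup>2)"
    and var_upper: "0 < e \<Longrightarrow> \<exists>M\<in>\<Theta>. su\<^sup>2 - e < (LINT x|M. x\<^sup>2)"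
    and var_lower: "0 < e \<Longrightarrow> \<exists>M\<in>\<Theta>. (LINT x|M. x\<^sup>2) < sl\<^sup>2 + e"
    and int5: "M \<in> \<Theta> \<Longrightarrow> integrable M (\<lambda>x. \<bar>x\<bar> powr (5/2))"
    and m5_le: "M \<in> \<Theta> \<Longrightarrow> (LINT x|M. \<bar>x\<bar> powr (5/2)) \<le> M5"

text \<open>A bound on the supremum holds for each measure. In particular the two conditions on the
  mean force every member of \<open>\<Theta>\<close> to have mean 0.\<close>

lemma moment_familyI:
  assumes ne: "\<Theta> \<noteq> {}" and d: "\<And>M. M \<in> \<Theta> \<Longrightarrow> real_distribution M" and "0 < su"
    and e1: "ext_expectation \<Theta> (\<lambda>x. x) = 0" and e1': "ext_expectation \<Theta> (\<lambda>x. - x) = 0"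
    and e2: "ext_expectation \<Theta> (\<lambda>x. x\<^sup>2) = ereal (su\<^sup>2)"
    and e2': "- ext_expectation \<Theta> (\<lambda>x. - (x\<^sup>2)) = ereal (sl\<^sup>2)"
    and e5: "ext_expectation \<Theta> (\<lambda>x. \<bar>x\<bar> powr (5/2)) = ereal M5"
  shows "moment_family \<Theta> sl su M5"
proof (rule moment_family.intro)
  have le: "ext_integral M f \<le> ext_expectation \<Theta> f" if "M \<in> \<Theta>" for M f
    unfolding ext_expectation_def using that by (rule SUP_upper)
  have e2'': "ext_expectation \<Theta> (\<lambda>x. - (x\<^sup>2)) = ereal (- (sl\<^sup>2))"
    using e2' by (metis ereal_uminus_eq_reorder uminus_ereal.simps(1))
  fix M assume M: "M \<in> \<Theta>"
  interpret real_distribution M by (rule d[OF M])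
  show i2: "integrable M (\<lambda>x. x\<^sup>2)"
    by (rule ext_integral_nonneg_integrable[of _ _ "su\<^sup>2"]) (use le[OF M, of "\<lambda>x. x\<^sup>2"] e2 in auto)
  show i5: "integrable M (\<lambda>x. \<bar>x\<bar> powr (5/2))"
    by (rule ext_integral_nonneg_integrable[of _ _ M5])
      (use le[OF M, of "\<lambda>x. \<bar>x\<bar> powr (5/2)"] e5 in auto)
  show i1: "integrable M (\<lambda>x. x)"
    by (rule square_integrable_imp_integrable[OF _ i2]) simp
  show "(LINT x|M. x) = 0"
    using le[OF M, of "\<lambda>x. x"] le[OF M, of "\<lambda>x. - x"] e1 e1' i1
    by (simp add: ext_integral_eq)
  show "(LINT x|M. x\<^sup>2) \<le> su\<^sup>2"
    using le[OF M, of "\<lambda>x. x\<^sup>2"] e2 i2 by (simp add: ext_integral_eq)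
  show "sl\<^sup>2 \<le> (LINT x|M. x\<^sup>2)"
    using le[OF M, of "\<lambda>x. - (x\<^sup>2)"] e2'' i2 by (simp add: ext_integral_eq)
  show "(LINT x|M. \<bar>x\<bar> powr (5/2)) \<le> M5"
    using le[OF M, of "\<lambda>x. \<bar>x\<bar> powr (5/2)"] e5 i5 by (simp add: ext_integral_eq)
next
  have e2'': "ext_expectation \<Theta> (\<lambda>x. - (x\<^sup>2)) = ereal (- (sl\<^sup>2))"
    using e2' by (metis ereal_uminus_eq_reorder uminus_ereal.simps(1))
  have i2: "integrable M (\<lambda>x. x\<^sup>2)" if M: "M \<in> \<Theta>" for M
  proof -
    interpret real_distribution M by (rule d[OF M])
    have "ext_integral M (\<lambda>x. x\<^sup>2) \<le> ext_expectation \<Theta> (\<lambda>x. x\<^sup>2)"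
      unfolding ext_expectation_def using M by (rule SUP_upper)
    then show ?thesis by (intro ext_integral_nonneg_integrable[of _ _ "su\<^sup>2"]) (auto simp: e2)
  qed
  fix e :: real assume "0 < e"
  then have "ereal (su\<^sup>2 - e) < ext_expectation \<Theta> (\<lambda>x. x\<^sup>2)"
    "ereal (- (sl\<^sup>2) - e) < ext_expectation \<Theta> (\<lambda>x. - (x\<^sup>2))"
    by (auto simp: e2 e2'')
  then obtain M M' where "M \<in> \<Theta>" "ereal (su\<^sup>2 - e) < ext_integral M (\<lambda>x. x\<^sup>2)"
    "M' \<in> \<Theta>" "ereal (- (sl\<^sup>2) - e) < ext_integral M' (\<lambda>x. - (x\<^sup>2))"
    unfolding ext_expectation_def less_SUP_iff by blast
  then show "\<exists>M\<in>\<Theta>. su\<^sup>2 - e < (LINT x|M. x\<^sup>2)" "\<exists>M\<in>\<Theta>. (LINT x|M. x\<^sup>2) < sl\<^sup>2 + e"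
    using i2[of M] i2[of M'] by (force simp: ext_integral_eq)+
qed (use assms in auto)

context moment_family
begin

definition sup_expect :: "(real \<Rightarrow> real) \<Rightarrow> real" where
  "sup_expect f = (SUP M\<in>\<Theta>. LINT x|M. f x)"

lemma CbLip_integrable:
  assumes "f \<in> CbLip" "M \<in> \<Theta>"
  shows "integrable M f"
proof -
  interpret real_distribution M by (rule distr[OF assms(2)])
  obtain B L where B: "\<And>x. \<bar>f x\<bar> \<le> B" and L: "L-lipschitz_on UNIV f"
    using assms(1) by (auto simp: CbLip_def bounded_iff)
  have "f \<in> borel_measurable borel"
    by (rule borel_measurable_continuous_onI[OF lipschitz_on_continuous_on[OF L]])
  then show ?thesis
    using B by (intro integrable_const_bound[of _ B]) auto
qed

lemma integral_le_sup_expect: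
  assumes "f \<in> CbLip" "M \<in> \<Theta>"
  shows "(LINT x|M. f x) \<le> sup_expect f"
proof -
  obtain B where B: "\<And>x. \<bar>f x\<bar> \<le> B"
    using assms(1) by (auto simp: CbLip_def bounded_iff)
  have "(LINT x|N. f x) \<le> B" if N: "N \<in> \<Theta>" for N
  proof -
    interpret N: real_distribution N by (rule distr[OF N])
    have "(LINT x|N. f x) \<le> (LINT x|N. B)"
      using B by (intro integral_mono CbLip_integrable[OF assms(1) N]) (auto simp: abs_le_iff)
    then show ?thesis using N.prob_space by simp
  qed
  then have "bdd_above ((\<lambda>M. LINT x|M. f x) ` \<Theta>)" by (rule bdd_aboveI2)
  then show ?thesis unfolding sup_expect_def by (rule cSUP_upper[OF assms(2)])
qed

lemma sup_expect_le:
  assumes "\<And>M. M \<in> \<Theta> \<Longrightarrow> (LINT x|M. f x) \<le> c"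
  shows "sup_expect f \<le> c"
  unfolding sup_expect_def by (rule cSUP_least[OF nonempty assms])

text \<open>Splitting at \<open>\<bar>x\<bar> = su / 2\<close> shows that the 5/2 moment carries
  three quarters of the variance. This lets error terms without a moment factor be absorbed into a
  multiple of \<open>M5\<close>.\<close>

lemma M5_lower_bound: "3 / 4 * su\<^sup>2 * sqrt (su / 2) \<le> M5"
proof -
  define a where "a = su / 2"
  have a: "a > 0" using su_pos by (simp add: a_def)
  have pw: "x\<^sup>2 \<le> a\<^sup>2 + \<bar>x\<bar> powr (5/2) / sqrt a" for x
  proof (cases "\<bar>x\<bar> \<le> a")
    case True
    then have "x\<^sup>2 \<le> a\<^sup>2" by (metis abs_ge_zero power2_abs power_mono)
    moreover have "\<bar>x\<bar> powr (5/2) / sqrt a \<ge> 0" using a by simp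
    ultimately show ?thesis by linarith
  next
    case False
    then have x: "x \<noteq> 0" "a \<le> \<bar>x\<bar>" using a by auto
    have "x\<^sup>2 * sqrt a \<le> x\<^sup>2 * sqrt \<bar>x\<bar>" using x by (intro mult_left_mono) auto
    also have "\<dots> = \<bar>x\<bar> powr (2 + 1/2)" using x unfolding powr_add by (simp add: powr_half_sqrt)
    finally have "x\<^sup>2 \<le> \<bar>x\<bar> powr (5/2) / sqrt a" using a by (simp add: field_simps)
    then show ?thesis by (simp add: add_increasing)
  qed
  have *: "(LINT x|M. x\<^sup>2) \<le> a\<^sup>2 + M5 / sqrt a" if M: "M \<in> \<Theta>" for M
  proof -
    interpret real_distribution M by (rule distr[OF M])
    have "(LINT x|M. x\<^sup>2) \<le> (LINT x|M. a\<^sup>2 + \<bar>x\<bar> powr (5/2) / sqrt a)"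
      using int2[OF M] int5[OF M] pw by (intro integral_mono) auto
    also have "\<dots> = a\<^sup>2 + (LINT x|M. \<bar>x\<bar> powr (5/2)) / sqrt a"
      using int5[OF M] prob_space by simp
    also have "\<dots> \<le> a\<^sup>2 + M5 / sqrt a"
      using m5_le[OF M] a by (simp add: divide_right_mono)
    finally show ?thesis .
  qed
  have "su\<^sup>2 \<le> a\<^sup>2 + M5 / sqrt a"
  proof (rule field_le_epsilon)
    fix e :: real assume "0 < e"
    then obtain M where "M \<in> \<Theta>" "su\<^sup>2 - e < (LINT x|M. x\<^sup>2)" using var_upper by blast
    with * show "su\<^sup>2 \<le> a\<^sup>2 + M5 / sqrt a + e" by fastforce
  qed
  then show ?thesis using a by (simp add: a_def field_simps power2_eq_square)
qed

lemma M5_pos: "0 < M5"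
  using M5_lower_bound su_pos by (smt (verit) divide_pos_pos mult_pos_pos real_sqrt_gt_zero zero_less_power)

text \<open>A crude bound for the step that starts from the initial value, where second derivatives
  are not controlled. The estimate \<open>\<bar>y\<bar> \<le> 1 + y\<^sup>2\<close> brings in only
  the variance.\<close>

lemma one_step_lipschitz:
  assumes "f \<in> CbLip" "1-lipschitz_on UNIV f" "0 < s"
  shows "\<bar>sup_expect (\<lambda>y. f (x + s * y)) - f x\<bar> \<le> s * (1 + su\<^sup>2)"
proof -
  have *: "\<bar>(LINT y|M. f (x + s * y)) - f x\<bar> \<le> s * (1 + su\<^sup>2)" if M: "M \<in> \<Theta>" for M
  proof -
    interpret real_distribution M by (rule distr[OF M])
    have i: "integrable M (\<lambda>y. f (x + s * y))" by (rule CbLip_integrable[OF CbLip_affine[OF assms(1)] M])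
    have "\<bar>(LINT y|M. f (x + s * y)) - f x\<bar> = \<bar>LINT y|M. f (x + s * y) - f x\<bar>"
      using i prob_space by simp
    also have "\<dots> \<le> (LINT y|M. \<bar>f (x + s * y) - f x\<bar>)"
      by (rule integral_abs_bound)
    also have "\<dots> \<le> (LINT y|M. s * (1 + y\<^sup>2))"
    proof (rule integral_mono)
      fix y
      have "\<bar>f (x + s * y) - f x\<bar> \<le> s * \<bar>y\<bar>"
        using lipschitz_onD[OF assms(2), of "x + s * y" x] \<open>0 < s\<close> by (simp add: dist_real_def abs_mult)
      also have "\<bar>y\<bar> \<le> 1 + y\<^sup>2"
        using sum_squares_ge_zero[of "\<bar>y\<bar> - 1" 0] zero_le_power2[of y] by (simp add: power2_eq_square algebra_simps)
      finally show "\<bar>f (x + s * y) - f x\<bar> \<le> s * (1 + y\<^sup>2)" using \<open>0 < s\<close> by simp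
    qed (use i int2[OF M] in auto)
    also have "\<dots> = s * (1 + (LINT y|M. y\<^sup>2))" using int2[OF M] prob_space by simp
    also have "\<dots> \<le> s * (1 + su\<^sup>2)" using var_le[OF M] \<open>0 < s\<close> by simp
    finally show ?thesis .
  qed
  obtain M where M: "M \<in> \<Theta>" using nonempty by blast
  have "sup_expect (\<lambda>y. f (x + s * y)) \<le> f x + s * (1 + su\<^sup>2)"
    using * by (intro sup_expect_le) (force simp: abs_le_iff)
  moreover have "f x - s * (1 + su\<^sup>2) \<le> sup_expect (\<lambda>y. f (x + s * y))"
    using *[OF M] integral_le_sup_expect[OF CbLip_affine[OF assms(1)] M, of x s] by linarith
  ultimately show ?thesis by linarith
qed

text \<open>Mean 0 removes the first-order Taylor term under every measure, and the supremum of the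
  second-order terms \<open>a / 2 * (LINT y|M. y\<^sup>2)\<close> is \<open>G_fun sl su a\<close>.
  The sign of \<open>a\<close> decides which extreme variance is relevant.\<close>

lemma one_step_smooth:
  assumes CbLip: "f \<in> CbLip"
    and f: "\<And>x. (f has_real_derivative f' x) (at x)"
    and f': "\<And>x. (f' has_real_derivative f'' x) (at x)"
    and hoelder: "\<And>x y. \<bar>f'' x - f'' y\<bar> \<le> H * sqrt \<bar>x - y\<bar>"
    and "0 < s"
  shows "\<bar>sup_expect (\<lambda>y. f (x + s * y)) - f x - s\<^sup>2 * G_fun sl su (f'' x)\<bar>
    \<le> H / 2 * (s\<^sup>2 * sqrt s) * M5"
proof -
  define err where "err = H / 2 * (s\<^sup>2 * sqrt s) * M5"
  define a where "a = f'' x"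
  define S where "S = sup_expect (\<lambda>y. f (x + s * y))"
  have "0 \<le> H" using hoelder[of 1 0] by simp
  have *: "\<bar>(LINT y|M. f (x + s * y)) - f x - s\<^sup>2 * (a / 2 * (LINT y|M. y\<^sup>2))\<bar> \<le> err" if M: "M \<in> \<Theta>" for M
  proof -
    interpret real_distribution M by (rule distr[OF M])
    have i: "integrable M (\<lambda>y. f (x + s * y))" by (rule CbLip_integrable[OF CbLip_affine[OF CbLip] M])
    note ints = i int1[OF M] int2[OF M] int5[OF M]
    have eq: "(LINT y|M. f (x + s * y)) - f x - s\<^sup>2 * (a / 2 * (LINT y|M. y\<^sup>2))
      = (LINT y|M. f (x + s * y) - f x - f' x * s * y - s\<^sup>2 * (a / 2) * y\<^sup>2)"
      using ints mean0[OF M] prob_space by simp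
    have "\<bar>(LINT y|M. f (x + s * y)) - f x - s\<^sup>2 * (a / 2 * (LINT y|M. y\<^sup>2))\<bar>
      \<le> (LINT y|M. \<bar>f (x + s * y) - f x - f' x * s * y - s\<^sup>2 * (a / 2) * y\<^sup>2\<bar>)"
      unfolding eq by (rule integral_abs_bound)
    also have "\<dots> \<le> (LINT y|M. H / 2 * (s\<^sup>2 * sqrt s) * \<bar>y\<bar> powr (5/2))"
    proof (rule integral_mono)
      fix y :: real
      have "f' x * s * y = f' x * (s * y)" "s\<^sup>2 * (a / 2) * y\<^sup>2 = f'' x / 2 * (s * y)\<^sup>2"
        by (simp_all add: a_def power_mult_distrib)
      then have "\<bar>f (x + s * y) - f x - f' x * s * y - s\<^sup>2 * (a / 2) * y\<^sup>2\<bar>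
        \<le> H / 2 * ((s * y)\<^sup>2 * sqrt \<bar>s * y\<bar>)"
        using taylor_hoelder[OF f f' hoelder, of x "s * y"] by presburger
      also have "(s * y)\<^sup>2 * sqrt \<bar>s * y\<bar> = (s\<^sup>2 * sqrt s) * (\<bar>y\<bar>\<^sup>2 * sqrt \<bar>y\<bar>)"
        using \<open>0 < s\<close> by (simp add: abs_mult real_sqrt_mult power_mult_distrib)
      also have "\<bar>y\<bar>\<^sup>2 * sqrt \<bar>y\<bar> = \<bar>y\<bar> powr (2 + 1/2)"
        unfolding powr_add by (cases "y = 0") (auto simp: powr_half_sqrt)
      finally show "\<bar>f (x + s * y) - f x - f' x * s * y - s\<^sup>2 * (a / 2) * y\<^sup>2\<bar>
        \<le> H / 2 * (s\<^sup>2 * sqrt s) * \<bar>y\<bar> powr (5/2)" by simp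
    qed (use ints in auto)
    also have "\<dots> = H / 2 * (s\<^sup>2 * sqrt s) * (LINT y|M. \<bar>y\<bar> powr (5/2))"
      using ints by simp
    also have "\<dots> \<le> err"
      unfolding err_def using \<open>0 \<le> H\<close> \<open>0 < s\<close> m5_le[OF M] by (intro mult_left_mono) auto
    finally show ?thesis .
  qed
  have G: "a / 2 * (LINT y|M. y\<^sup>2) \<le> G_fun sl su a" if M: "M \<in> \<Theta>" for M
  proof (cases "0 \<le> a")
    case True
    then show ?thesis
      using mult_left_mono[OF var_le[OF M], of "a / 2"] by (simp add: G_fun_def mult_ac)
  next
    case False
    then show ?thesis
      using mult_left_mono[OF var_ge[OF M], of "- a / 2"] by (simp add: G_fun_def mult_ac)
  qed
  have upper: "S \<le> f x + s\<^sup>2 * G_fun sl su a + err"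
    unfolding S_def
  proof (rule sup_expect_le)
    fix M assume M: "M \<in> \<Theta>"
    show "(LINT y|M. f (x + s * y)) \<le> f x + s\<^sup>2 * G_fun sl su a + err"
      using *[OF M] mult_left_mono[OF G[OF M], of "s\<^sup>2"] by (simp add: abs_le_iff)
  qed
  have low: "s\<^sup>2 * (a / 2 * (LINT y|M. y\<^sup>2)) \<le> S - f x + err" if M: "M \<in> \<Theta>" for M
    using *[OF M] integral_le_sup_expect[OF CbLip_affine[OF CbLip] M, of x s]
    unfolding S_def by linarith
  have "s\<^sup>2 * G_fun sl su a \<le> S - f x + err"
  proof (rule field_le_epsilon)
    fix e :: real assume "0 < e"
    \<comment> \<open>A measure with variance within \<open>d\<close> of the extreme one loses at
      most \<open>s\<^sup>2 * \<bar>a\<bar> / 2 * d\<close>, hence at most \<open>e\<close>. The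
      summand 1 covers \<open>a = 0\<close>.\<close>
    define d where "d = e / (s\<^sup>2 * \<bar>a\<bar> / 2 + 1)"
    have q: "s\<^sup>2 * \<bar>a\<bar> / 2 + 1 > 0" by (intro add_nonneg_pos) auto
    then have "d > 0" using \<open>0 < e\<close> by (simp add: d_def)
    have "s\<^sup>2 * \<bar>a\<bar> / 2 * d \<le> (s\<^sup>2 * \<bar>a\<bar> / 2 + 1) * d" using \<open>d > 0\<close> by (intro mult_right_mono) auto
    also have "\<dots> = e" using q by (simp add: d_def)
    finally have de: "s\<^sup>2 * (\<bar>a\<bar> / 2 * d) \<le> e" by simp
    show "s\<^sup>2 * G_fun sl su a \<le> S - f x + err + e"
    proof (cases "0 \<le> a")
      case True
      obtain M where M: "M \<in> \<Theta>" "su\<^sup>2 - d < (LINT y|M. y\<^sup>2)" using var_upper[OF \<open>d > 0\<close>] by blast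
      have "s\<^sup>2 * (a / 2 * (su\<^sup>2 - d)) \<le> s\<^sup>2 * (a / 2 * (LINT y|M. y\<^sup>2))"
        using True M by (intro mult_left_mono) auto
      with low[OF M(1)] de True show ?thesis by (simp add: G_fun_def algebra_simps)
    next
      case False
      obtain M where M: "M \<in> \<Theta>" "(LINT y|M. y\<^sup>2) < sl\<^sup>2 + d" using var_lower[OF \<open>d > 0\<close>] by blast
      have "s\<^sup>2 * (- a / 2 * (LINT y|M. y\<^sup>2)) \<le> s\<^sup>2 * (- a / 2 * (sl\<^sup>2 + d))"
        using False M by (intro mult_left_mono) auto
      with low[OF M(1)] de False show ?thesis by (simp add: G_fun_def algebra_simps)
    qed
  qed
  with upper have "\<bar>S - f x - s\<^sup>2 * G_fun sl su a\<bar> \<le> err" by linarith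
  then show ?thesis by (simp only: S_def err_def a_def)
qed

end

section \<open>Transition operators and the telescoping sum\<close>

context sublinear_expectation_space
begin

lemma CbLip_comp_mem:
  assumes "Z \<in> H" "\<psi> \<in> CbLip"
  shows "(\<lambda>w. \<psi> (Z w)) \<in> H"
proof -
  obtain L where L: "L-lipschitz_on UNIV \<psi>" and b: "bounded (range \<psi>)"
    using assms(2) by (auto simp: CbLip_def)
  have "(\<lambda>z. \<psi> (z 0)) \<in> CbLip_dim 1"
    unfolding CbLip_dim_def
  proof (intro CollectI conjI exI allI)
    show "bounded (range (\<lambda>z :: nat \<Rightarrow> real. \<psi> (z 0)))"
      by (rule bounded_subset[OF b]) auto
    show "\<bar>\<psi> (x 0) - \<psi> (y 0)\<bar> \<le> L * L2_set (\<lambda>i. x i - y i) {..<1}" for x y :: "nat \<Rightarrow> real"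
      using lipschitz_onD[OF L, of "x 0" "y 0"] by (simp add: dist_real_def L2_set_def)
  qed
  from comp_mem[OF _ this, of "\<lambda>_. Z"] assms(1) show ?thesis by simp
qed

text \<open>Constants are compositions with no arguments: they belong to
  \<open>CbLip_dim 0\<close>.\<close>

lemma const_mem: "(\<lambda>_. c) \<in> H"
  using comp_mem[of 0 "\<lambda>_ _. 0" "\<lambda>_. c"] by (auto simp: CbLip_dim_def)

lemma sum_mem: "(\<And>i. i \<in> I \<Longrightarrow> Z i \<in> H) \<Longrightarrow> (\<lambda>w. \<Sum>i\<in>I. Z i w) \<in> H"
  by (induction I rule: infinite_finite_induct) (auto intro: zero_mem add_mem)

lemma E_abs_diff_le:
  assumes "A \<in> H" "B \<in> H" "\<And>w. \<bar>A w - B w\<bar> \<le> c"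
  shows "\<bar>E A - E B\<bar> \<le> c"
proof -
  have *: "E A \<le> E B + c" if "A \<in> H" "B \<in> H" "\<And>w. \<bar>A w - B w\<bar> \<le> c" for A B
  proof -
    have "E A \<le> E (\<lambda>w. B w + c)"
    proof (rule E_mono)
      show "A w \<le> B w + c" for w using that(3)[of w] by (simp add: abs_le_iff)
    qed (use that add_mem const_mem in auto)
    also have "\<dots> \<le> E B + E (\<lambda>_. c)" by (rule E_subadd) (use that const_mem in auto)
    finally show ?thesis by (simp add: E_const)
  qed
  have "E A \<le> E B + c" "E B \<le> E A + c"
    using *[of A B] *[of B A] assms by (auto simp: abs_minus_commute)
  then show ?thesis by (simp add: abs_le_iff)
qed

definition transition :: "('w \<Rightarrow> real) \<Rightarrow> real \<Rightarrow> (real \<Rightarrow> real) \<Rightarrow> real \<Rightarrow> real" where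
  "transition Z s \<psi> x = E (\<lambda>w. \<psi> (x + s * Z w))"

lemma transition_CbLip:
  assumes "Z \<in> H" "\<psi> \<in> CbLip"
  shows "transition Z s \<psi> \<in> CbLip"
proof -
  obtain B L where B: "\<And>x. \<bar>\<psi> x\<bar> \<le> B" and L: "L-lipschitz_on UNIV \<psi>"
    using assms by (auto simp: CbLip_def bounded_iff)
  have mem: "(\<lambda>w. \<psi> (x + s * Z w)) \<in> H" for x
    by (rule CbLip_comp_mem[OF assms(1) CbLip_affine[OF assms(2)]])
  have "L-lipschitz_on UNIV (transition Z s \<psi>)"
  proof (rule lipschitz_onI)
    show "dist (transition Z s \<psi> x) (transition Z s \<psi> y) \<le> L * dist x y" for x y
      unfolding transition_def dist_real_def
    proof (rule E_abs_diff_le[OF mem mem])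
      show "\<bar>\<psi> (x + s * Z w) - \<psi> (y + s * Z w)\<bar> \<le> L * \<bar>x - y\<bar>" for w
        using lipschitz_onD[OF L, of "x + s * Z w" "y + s * Z w"] by (simp add: dist_real_def)
    qed
  qed (rule lipschitz_on_nonneg[OF L])
  moreover have "\<bar>transition Z s \<psi> x\<bar> \<le> B" for x
    using E_abs_diff_le[OF mem const_mem[of 0], of x B] B by (simp add: transition_def E_const)
  ultimately show ?thesis by (rule CbLip_lipschitzI)
qed

text \<open>Independence puts the expectation over the last variable inside, where identical
  distribution replaces \<open>X (k + 1)\<close> by \<open>X 1\<close>. For \<open>k = 0\<close>,
  where independence says nothing, the sum is empty and the outer expectation is that of a
  constant.\<close>

lemma iid_transition:
  assumes iid: "iid_sequence H E X" and "\<psi> \<in> CbLip"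
  shows "E (\<lambda>w. \<psi> (s * (\<Sum>i=1..k + 1. X i w))) = E (\<lambda>w. transition (X 1) s \<psi> (s * (\<Sum>i=1..k. X i w)))"
proof (cases "k = 0")
  case True
  then show ?thesis by (simp add: transition_def E_const)
next
  case False
  obtain B L where B: "\<And>x. \<bar>\<psi> x\<bar> \<le> B" and L: "L-lipschitz_on UNIV \<psi>"
    using assms by (auto simp: CbLip_def bounded_iff)
  define \<Psi> where "\<Psi> = (\<lambda>z. \<psi> (s * (\<Sum>i<k + 1. z i)))"
  have "\<Psi> \<in> CbLip_dim (k + 1)"
    unfolding CbLip_dim_def
  proof (intro CollectI conjI exI allI)
    show "bounded (range \<Psi>)" using B by (auto simp: bounded_iff \<Psi>_def)
    fix x y :: "nat \<Rightarrow> real"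
    \<comment> \<open>Membership in \<open>CbLip_dim\<close> asks for some Lipschitz constant only,
      so the crude factor \<open>k + 1\<close> between the sum and the Euclidean norm
      suffices.\<close>
    have "\<bar>\<Sum>i<k + 1. x i - y i\<bar> \<le> (\<Sum>i<k + 1. \<bar>x i - y i\<bar>)" by (rule sum_abs)
    also have "\<dots> \<le> (\<Sum>i<k + 1. L2_set (\<lambda>i. x i - y i) {..<k + 1})"
    proof (rule sum_mono)
      show "\<bar>x i - y i\<bar> \<le> L2_set (\<lambda>i. x i - y i) {..<k + 1}" if "i \<in> {..<k + 1}" for i
        using member_le_L2_set[OF _ that, of "\<lambda>i. \<bar>x i - y i\<bar>"]
        by (simp add: L2_set_def del: sum.lessThan_Suc)
    qed
    also have "\<dots> = real (k + 1) * L2_set (\<lambda>i. x i - y i) {..<k + 1}" by simp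
    finally have le: "\<bar>\<Sum>i<k + 1. x i - y i\<bar> \<le> real (k + 1) * L2_set (\<lambda>i. x i - y i) {..<k + 1}" .
    have "\<bar>\<Psi> x - \<Psi> y\<bar> \<le> L * \<bar>s * (\<Sum>i<k + 1. x i) - s * (\<Sum>i<k + 1. y i)\<bar>"
      using lipschitz_onD[OF L, of "s * (\<Sum>i<k + 1. x i)" "s * (\<Sum>i<k + 1. y i)"]
      by (simp add: \<Psi>_def dist_real_def del: sum.lessThan_Suc)
    also have "\<dots> = L * \<bar>s\<bar> * \<bar>\<Sum>i<k + 1. x i - y i\<bar>"
      by (simp add: right_diff_distrib[symmetric] sum_subtractf[symmetric] abs_mult del: sum.lessThan_Suc)
    also have "\<dots> \<le> L * \<bar>s\<bar> * (real (k + 1) * L2_set (\<lambda>i. x i - y i) {..<k + 1})"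
      using lipschitz_on_nonneg[OF L] by (intro mult_left_mono le) auto
    finally show "\<bar>\<Psi> x - \<Psi> y\<bar> \<le> (L * \<bar>s\<bar> * real (k + 1)) * L2_set (\<lambda>i. x i - y i) {..<k + 1}"
      by (simp only: mult.assoc)
  qed
  moreover have "independent_from E 1 (\<lambda>_. X (k + 1)) k (\<lambda>j. X (j + 1))"
    using iid False by (auto simp: iid_sequence_def)
  ultimately have ind: "E (\<lambda>w. \<Psi> (join_vec k (\<lambda>j. X (j + 1) w) (\<lambda>_. X (k + 1) w))) =
      E (\<lambda>w. E (\<lambda>w'. \<Psi> (join_vec k (\<lambda>j. X (j + 1) w) (\<lambda>_. X (k + 1) w'))))"
    by (simp add: independent_from_def)
  have join: "\<Psi> (join_vec k (\<lambda>j. X (j + 1) w) (\<lambda>_. X (k + 1) w')) = \<psi> (s * (\<Sum>i=1..k. X i w) + s * X (k + 1) w')"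
    for w w'
  proof -
    have "(\<Sum>i<k. join_vec k (\<lambda>j. X (j + 1) w) (\<lambda>_. X (k + 1) w') i) = (\<Sum>i<k. X (Suc i) w)"
      by (intro sum.cong) (auto simp: join_vec_def)
    also have "\<dots> = (\<Sum>i=1..k. X i w)" by (simp add: sum.atLeast1_atMost_eq)
    finally show ?thesis by (simp add: \<Psi>_def join_vec_def distrib_left)
  qed
  have "identically_distributed E (X (k + 1)) (X 1)"
    using iid by (auto simp: iid_sequence_def)
  then have same: "E (\<lambda>w'. \<psi> (x + s * X (k + 1) w')) = transition (X 1) s \<psi> x" for x
    
    using bspec[OF _ CbLip_affine[OF assms(2), of x s]]
    by (simp only: identically_distributed_def transition_def)
  from ind show ?thesis
    unfolding join same by (simp add: distrib_left)
qed

text \<open>The sequence \<open>a k\<close>, the expectation of \<open>u\<close> at the partial sum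
  \<open>S k\<close> with remaining time \<open>1 - k / n\<close>, leads from \<open>u 0 1\<close>
  to the expectation of \<open>u (normalized_sum X n w) 0\<close>. Passing from \<open>k\<close> to
  \<open>k + 1\<close> costs the one-step error with \<open>j = n - (k + 1)\<close>.\<close>

lemma telescoping_bound:
  assumes iid: "iid_sequence H E X" and "0 < n"
    and CbLip: "\<And>t. 0 \<le> t \<Longrightarrow> (\<lambda>x. u x t) \<in> CbLip"
    and step: "\<And>j x. j < n \<Longrightarrow>
      \<bar>transition (X 1) (1 / sqrt n) (\<lambda>x. u x (j / n)) x - u x (j / n + 1 / n)\<bar> \<le> \<delta> j"
  shows "\<bar>E (\<lambda>w. u (normalized_sum X n w) 0) - u 0 1\<bar> \<le> (\<Sum>j<n. \<delta> j)"
proof -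
  define s where "s = 1 / sqrt (real n)"
  define S where "S = (\<lambda>k w. s * (\<Sum>i=1..k. X i w))"
  have XH: "X i \<in> H" if "i \<ge> 1" for i using iid that by (auto simp: iid_sequence_def)
  have SH: "S k \<in> H" for k unfolding S_def by (intro scale_mem sum_mem XH) auto
  define a where "a = (\<lambda>k. E (\<lambda>w. u (S k w) (1 - k / n)))"
  have step': "\<bar>a (Suc k) - a k\<bar> \<le> \<delta> (n - Suc k)" if "k < n" for k
  proof -
    define j where "j = n - Suc k"
    have "j < n" using that \<open>0 < n\<close> by (simp add: j_def)
    have t: "1 - real (Suc k) / n = j / n" "1 - real k / n = j / n + 1 / n"
      using that \<open>0 < n\<close> by (auto simp: j_def field_simps of_nat_diff)
    have "a (Suc k) = E (\<lambda>w. transition (X 1) s (\<lambda>x. u x (j / n)) (S k w))"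
      unfolding a_def t S_def using iid_transition[OF iid CbLip, of "j / n" s k] by simp
    moreover have "a k = E (\<lambda>w. u (S k w) (j / n + 1 / n))" by (simp add: a_def t)
    moreover have "\<bar>E (\<lambda>w. transition (X 1) s (\<lambda>x. u x (j / n)) (S k w)) - E (\<lambda>w. u (S k w) (j / n + 1 / n))\<bar> \<le> \<delta> j"
    proof (rule E_abs_diff_le)
      show "(\<lambda>w. transition (X 1) s (\<lambda>x. u x (j / n)) (S k w)) \<in> H"
        by (intro CbLip_comp_mem[OF SH] transition_CbLip XH CbLip) auto
      show "(\<lambda>w. u (S k w) (j / n + 1 / n)) \<in> H"
        by (intro CbLip_comp_mem[OF SH CbLip]) auto
    qed (use step[OF \<open>j < n\<close>] in \<open>simp add: s_def\<close>)
    ultimately show ?thesis by (simp add: j_def)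
  qed
  have "\<bar>a n - a 0\<bar> = \<bar>\<Sum>k<n. a (Suc k) - a k\<bar>" by (simp add: sum_lessThan_telescope)
  also have "\<dots> \<le> (\<Sum>k<n. \<bar>a (Suc k) - a k\<bar>)" by (rule sum_abs)
  also have "\<dots> \<le> (\<Sum>k<n. \<delta> (n - Suc k))" by (intro sum_mono step') simp
  also have "\<dots> = (\<Sum>j<n. \<delta> j)" by (rule sum.nat_diff_reindex)
  finally show ?thesis
    using \<open>0 < n\<close> by (simp add: a_def S_def s_def normalized_sum_def E_const)
qed

end

section \<open>Summation of the one-step errors\<close>

lemma (in regular_G_heat_flow) u_CbLip:
  assumes "0 \<le> t"
  shows "(\<lambda>x. u x t) \<in> CbLip" "1-lipschitz_on UNIV (\<lambda>x. u x t)"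
proof -
  show l: "1-lipschitz_on UNIV (\<lambda>x. u x t)"
    using u_lipschitz[OF assms] by (intro lipschitz_onI) (auto simp: dist_real_def)
  obtain B where "\<And>x t. 0 \<le> t \<Longrightarrow> \<bar>u x t\<bar> \<le> B" using bound by blast
  then show "(\<lambda>x. u x t) \<in> CbLip" using assms by (intro CbLip_lipschitzI[OF l]) auto
qed

definition layer_const :: "real \<Rightarrow> real \<Rightarrow> real" where
  "layer_const sl su = 1 + su\<^sup>2 + 2 * ut_const sl su"

definition time_const :: "real \<Rightarrow> real \<Rightarrow> real" where
  "time_const sl su = su\<^sup>2 * (1 + 2 / sl\<^sup>2) * ut_lip_const sl su"

text \<open>The denominator is the lower bound of \<open>M5\<close>: dividing by it turns the errors
  without a moment factor into multiples of \<open>M5\<close>. The factor 4 comes from the sum of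
  the \<open>j powr (-3/4)\<close>; for the Hoelder term it meets the 1/2 of the Taylor remainder
  and leaves 2.\<close>

definition rate_const :: "real \<Rightarrow> real \<Rightarrow> real" where
  "rate_const sl su = (layer_const sl su + 4 * time_const sl su) / (3 / 4 * su\<^sup>2 * sqrt (su / 2))
     + 2 * uxx_hoelder_const sl su"

locale iid_G_heat_flow =
  sublinear_expectation_space H E + regular_G_heat_flow sl su u ut ux uxx K +
  moment_family \<Theta> sl su M5
  for H :: "('w \<Rightarrow> real) set" and E sl su u ut ux uxx K \<Theta> M5 +
  fixes X :: "nat \<Rightarrow> 'w \<Rightarrow> real"
  assumes iid: "iid_sequence H E X"
    and law: "represents_law E (X 1) \<Theta>"
begin

lemma transition_eq_sup_expect:
  assumes "\<psi> \<in> CbLip"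
  shows "transition (X 1) s \<psi> x = sup_expect (\<lambda>y. \<psi> (x + s * y))"
proof -
  have "\<forall>\<phi>\<in>CbLip. E (\<lambda>w. \<phi> (X 1 w)) = (SUP M\<in>\<Theta>. LINT x|M. \<phi> x)"
    using law by (simp add: represents_law_def)
  from bspec[OF this CbLip_affine[OF assms, of x s]] show ?thesis
    by (simp add: transition_def sup_expect_def)
qed

text \<open>For \<open>j = 0\<close> both the walk and the flow stay within order
  \<open>sqrt h\<close> of the initial value, where \<open>h = 1 / n\<close>. For
  \<open>t = j * h\<close> with \<open>j > 0\<close> the Taylor error is of order h^(5/4) t^(-3/4) =
  h^(1/2) j^(-3/4). The time discretisation error h^(3/2)/t = h^(1/2)/j is smaller and is weakened
  to the same form.\<close>

lemma step_error:
  fixes n j :: nat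
  assumes "0 < n" "j < n"
  shows "\<bar>transition (X 1) (1 / sqrt n) (\<lambda>x. u x (j / n)) x - u x (j / n + 1 / n)\<bar>
    \<le> 1 / sqrt n * (if j = 0 then layer_const sl su
        else (uxx_hoelder_const sl su / 2 * M5 + time_const sl su) * real j powr (-3/4))"
proof (cases "j = 0")
  case True
  have n: "1 / real n < 2" "1 / real n \<ge> 0" using assms by (auto simp: field_simps)
  have "\<bar>transition (X 1) (1 / sqrt n) (\<lambda>x. u x 0) x - u x 0\<bar> \<le> 1 / sqrt n * (1 + su\<^sup>2)"
    using one_step_lipschitz[OF u_CbLip, of 0 "1 / sqrt n" x]
      transition_eq_sup_expect[OF u_CbLip(1), of 0 "1 / sqrt n" x] assms by simp
  moreover have "\<bar>u x (1 / n) - u x 0\<bar> \<le> 2 * ut_const sl su * sqrt (1 / n)"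
    by (rule initial_layer) (use n in auto)
  ultimately have "\<bar>transition (X 1) (1 / sqrt n) (\<lambda>x. u x 0) x - u x (1 / n)\<bar>
      \<le> 1 / sqrt n * (1 + su\<^sup>2) + 2 * ut_const sl su * sqrt (1 / n)" by linarith
  also have "\<dots> = 1 / sqrt n * layer_const sl su"
    by (simp add: layer_const_def real_sqrt_divide algebra_simps add_divide_distrib)
  finally show ?thesis using True by simp
next
  case False
  define t where "t = real j / n"
  define h where "h = 1 / real n"
  have pos: "0 < t" "0 < h" "t < 2" "t + h < 2" "real n > 0" "0 < real j"
  proof -
    have "t + h \<le> 1" using assms by (simp add: t_def h_def field_simps)
    moreover show "0 < t" "0 < h" "real n > 0" "0 < real j" using assms False by (auto simp: t_def h_def)
    ultimately show "t < 2" "t + h < 2" by auto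
  qed
  have h: "1 / sqrt n = sqrt h" by (simp add: h_def real_sqrt_divide)
  have tj: "t = j * h" by (simp add: t_def h_def)
  have j1: "1 / real j \<le> real j powr (-3/4)"
  proof -
    have "real j powr (-1) \<le> real j powr (-3/4)" using False by (intro powr_mono) auto
    then show ?thesis using pos by (simp add: powr_minus_divide)
  qed
  have "\<bar>transition (X 1) (sqrt h) (\<lambda>x. u x t) x - u x t - (sqrt h)\<^sup>2 * G_fun sl su (uxx x t)\<bar>
      \<le> (uxx_hoelder_const sl su * t powr (-3/4)) / 2 * ((sqrt h)\<^sup>2 * sqrt (sqrt h)) * M5"
    using pos transition_eq_sup_expect one_step_smooth[OF u_CbLip(1) dx dxx uxx_hoelder, of t "sqrt h"]
      u_CbLip(1)[of t] by simp
  also have "\<dots> = uxx_hoelder_const sl su / 2 * M5 * (t powr (-3/4) * (h * sqrt (sqrt h)))"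
    using pos by simp
  also have "t powr (-3/4) * (h * sqrt (sqrt h)) = sqrt h * real j powr (-3/4)"
  proof -
    have "h * sqrt (sqrt h) = h powr 1 * h powr (1/4)"
      using pos by (simp add: powr_half_sqrt[symmetric] powr_powr)
    then have "t powr (-3/4) * (h * sqrt (sqrt h)) = real j powr (-3/4) * (h powr (-3/4) * (h powr 1 * h powr (1/4)))"
      using pos by (simp add: tj powr_mult)
    also have "h powr (-3/4) * (h powr 1 * h powr (1/4)) = h powr (1/2)"
      unfolding powr_add[symmetric] by simp
    finally show ?thesis using pos by (simp add: powr_half_sqrt)
  qed
  finally have 1: "\<bar>transition (X 1) (sqrt h) (\<lambda>x. u x t) x - u x t - h * G_fun sl su (uxx x t)\<bar>
    \<le> uxx_hoelder_const sl su / 2 * M5 * (sqrt h * real j powr (-3/4))" using pos by simp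
  have "\<bar>u x (t + h) - u x t - h * G_fun sl su (uxx x t)\<bar> \<le> time_const sl su * (h * sqrt h / t)"
    using time_step[OF pos(1,2,4)] by (simp add: time_const_def)
  also have "h * sqrt h / t = sqrt h * (1 / real j)" using pos by (simp add: tj)
  also have "time_const sl su * (sqrt h * (1 / real j)) \<le> time_const sl su * (sqrt h * real j powr (-3/4))"
    using consts_pos sl_pos su_pos pos unfolding time_const_def
    by (intro mult_left_mono j1 mult_nonneg_nonneg add_nonneg_nonneg) auto
  finally have "\<bar>transition (X 1) (sqrt h) (\<lambda>x. u x t) x - u x (t + h)\<bar>
    \<le> uxx_hoelder_const sl su / 2 * M5 * (sqrt h * real j powr (-3/4))
      + time_const sl su * (sqrt h * real j powr (-3/4))" using 1 by linarith
  then show ?thesis using False unfolding h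
    by (simp add: t_def[symmetric] h_def[symmetric] algebra_simps)
qed

lemma convergence_rate:
  assumes "0 < n"
  shows "\<bar>E (\<lambda>w. u (normalized_sum X n w) 0) - u 0 1\<bar> \<le> rate_const sl su * M5 / real n powr (1/4)"
proof -
  let ?l = "layer_const sl su" and ?c = "uxx_hoelder_const sl su / 2 * M5 + time_const sl su"
  define \<delta> where "\<delta> = (\<lambda>j. 1 / sqrt n * (if j = 0 then ?l else ?c * real j powr (-3/4)))"
  have tc: "time_const sl su \<ge> 0"
    using consts_pos sl_pos su_pos unfolding time_const_def by (intro mult_nonneg_nonneg add_nonneg_nonneg) auto
  have uc: "uxx_hoelder_const sl su \<ge> 0"
    using consts_pos sl_pos unfolding uxx_hoelder_const_def by (intro mult_nonneg_nonneg) auto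
  have c: "?c \<ge> 0" using tc uc M5_pos by (intro add_nonneg_nonneg mult_nonneg_nonneg) auto
  have l: "?l \<ge> 0" using consts_pos by (simp add: layer_const_def)
  \<comment> \<open>With \<open>m\<close> the fourth root of \<open>n\<close>, the prefactor is
    1/m^2 and the sum is at most \<open>4 * m\<close>, which leaves the rate \<open>1 / m\<close>;
    the term \<open>j = 0\<close>, of order 1/m^2, is even smaller.\<close>
  define m where "m = real n powr (1/4)"
  have m: "m \<ge> 1" unfolding m_def using assms by (simp add: ge_one_powr_ge_zero)
  have m2: "sqrt n = m * m"
    unfolding m_def powr_add[symmetric] using assms by (simp add: powr_half_sqrt[symmetric])
  have "\<bar>E (\<lambda>w. u (normalized_sum X n w) 0) - u 0 1\<bar> \<le> (\<Sum>j<n. \<delta> j)"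
    by (rule telescoping_bound[OF iid assms u_CbLip(1)])
      (use step_error[OF assms] in \<open>simp_all add: \<delta>_def\<close>)
  also have "(\<Sum>j<n. \<delta> j) = \<delta> 0 + (\<Sum>j=1..<n. \<delta> j)"
    using assms by (simp add: lessThan_atLeast0 sum.atLeast_Suc_lessThan)
  also have "(\<Sum>j=1..<n. \<delta> j) = 1 / sqrt n * ?c * (\<Sum>j=1..<n. real j powr (-3/4))"
    unfolding sum_distrib_left by (intro sum.cong) (auto simp: \<delta>_def)
  also have "\<dots> \<le> 1 / sqrt n * ?c * (4 * m)"
  proof (rule mult_left_mono)
    have "(\<Sum>j=1..<n. real j powr (-3/4)) \<le> (\<Sum>j=1..n. real j powr (-3/4))"
      by (intro sum_mono2) auto
    then show "(\<Sum>j=1..<n. real j powr (-3/4)) \<le> 4 * m"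
      using sum_powr_minus_three_quarters[of n] by (simp add: m_def)
  qed (use c in auto)
  also have "\<delta> 0 + 1 / sqrt n * ?c * (4 * m) = (?l / m + 4 * ?c) / m"
    using m by (simp add: \<delta>_def m2 field_simps)
  also have "\<dots> \<le> (?l + 4 * ?c) / m"
    using m l by (intro divide_right_mono add_right_mono) (auto simp: divide_le_eq mult_le_cancel_left1)
  also have "?l + 4 * ?c \<le> rate_const sl su * M5"
  proof -
    define q where "q = 3 / 4 * su\<^sup>2 * sqrt (su / 2)"
    have q: "0 < q" "q \<le> M5"
      using M5_lower_bound su_pos by (auto simp: q_def)
    have rc: "rate_const sl su = (?l + 4 * time_const sl su) / q + 2 * uxx_hoelder_const sl su"
      by (simp add: rate_const_def q_def)
    have "?l + 4 * time_const sl su = (?l + 4 * time_const sl su) / q * q" using q by simp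
    also have "\<dots> \<le> (?l + 4 * time_const sl su) / q * M5"
      using q l tc by (intro mult_left_mono) auto
    finally have le: "?l + 4 * time_const sl su \<le> (?l + 4 * time_const sl su) / q * M5" .
    have "?l + 4 * ?c = (?l + 4 * time_const sl su) + 2 * uxx_hoelder_const sl su * M5"
      by (simp add: algebra_simps)
    with le show ?thesis unfolding rc distrib_right by simp
  qed
  finally show ?thesis using m by (simp add: m_def divide_right_mono)
qed

end

section \<open>The rate of convergence\<close>

lemma G_heat_solution_flow:
  assumes "0 < sl" "sl \<le> su" "G_heat_solution sl su \<phi> u"
  obtains ut ux uxx where "G_heat_flow sl su u ut ux uxx"
proof -
  from assms(3) obtain ut ux uxx where
    c: "continuous_on (UNIV \<times> {0..}) (\<lambda>(x, t). u x t)"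
      "bounded ((\<lambda>(x, t). u x t) ` (UNIV \<times> {0..}))" and
    d: "\<forall>x. \<forall>t>0. ((\<lambda>s. u x s) has_real_derivative ut x t) (at t) \<and>
      ((\<lambda>y. u y t) has_real_derivative ux x t) (at x) \<and>
      ((\<lambda>y. ux y t) has_real_derivative uxx x t) (at x) \<and> ut x t - G_fun sl su (uxx x t) = 0"
    unfolding G_heat_solution_def by (elim conjE exE) (rule that)
  have "G_heat_flow sl su u ut ux uxx"
  proof
    fix t x :: real assume "0 < t"
    with d have *: "((\<lambda>s. u x s) has_real_derivative ut x t) (at t) \<and>
      ((\<lambda>y. u y t) has_real_derivative ux x t) (at x) \<and>
      ((\<lambda>y. ux y t) has_real_derivative uxx x t) (at x) \<and> ut x t - G_fun sl su (uxx x t) = 0"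
      by (elim allE impE)
    from * show "((\<lambda>s. u x s) has_real_derivative ut x t) (at t)" by (elim conjE)
    from * show "((\<lambda>y. u y t) has_real_derivative ux x t) (at x)" by (elim conjE)
    from * show "((\<lambda>y. ux y t) has_real_derivative uxx x t) (at x)" by (elim conjE)
    from * show "ut x t = G_fun sl su (uxx x t)" by simp
  qed (fact assms c)+
  then show ?thesis by (rule that)
qed

lemma normalized_sum_mem:
  assumes "sublinear_expectation_space H E" "iid_sequence H E X"
  shows "normalized_sum X n \<in> H"
proof -
  interpret sublinear_expectation_space H E by fact
  have "(\<lambda>w. 1 / sqrt (real n) * (\<Sum>i=1..n. X i w)) \<in> H"
    using assms(2) by (intro scale_mem sum_mem) (auto simp: iid_sequence_def)
  then show ?thesis unfolding normalized_sum_def by simp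
qed

text \<open>The regular flow needs an initial value with bounded second derivative, so
  \<open>\<phi>\<close> is replaced by a smooth \<open>g\<close> within \<open>e / 2\<close>. The
  sublinear expectation and, by comparison of flows, \<open>N\<close> each move by at most
  \<open>e / 2\<close>. The rate for \<open>g\<close> does not depend on \<open>K\<close>, so
  \<open>e\<close> may tend to 0.\<close>

lemma rate_for_finite_moment:
  assumes sl: "0 < sl" "sl \<le> su"
    and sp: "sublinear_expectation_space H E" and iid: "iid_sequence H E X"
    and law: "represents_law E (X 1) \<Theta>" and mom: "moment_family \<Theta> sl su M5"
    and N: "G_normal sl su N" and "0 < n"
    and \<phi>: "\<phi> \<in> CbLip" "1-lipschitz_on UNIV \<phi>"
  shows "\<bar>E (\<lambda>w. \<phi> (normalized_sum X n w)) - N \<phi>\<bar> \<le> rate_const sl su * M5 / real n powr (1/4)"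
proof (rule field_le_epsilon)
  fix e :: real assume "0 < e"
  then have "0 < e / 2" by simp
  from smooth_approximation[OF \<phi>(2,1) this] obtain g g' g'' K
    where g: "g \<in> CbLip" "1-lipschitz_on UNIV g" "\<And>x. \<bar>g x - \<phi> x\<bar> \<le> e / 2"
    "\<And>x. (g has_real_derivative g' x) (at x)" "\<And>x. (g' has_real_derivative g'' x) (at x)"
    "\<And>x. \<bar>g'' x\<bar> \<le> K" by metis
  obtain u v where u: "G_heat_solution sl su \<phi> u" "N \<phi> = u 0 1"
    and v: "G_heat_solution sl su g v" "N g = v 0 1"
    using N \<phi>(1) g(1) unfolding G_normal_def by blast
  obtain ut ux uxx where fu: "G_heat_flow sl su u ut ux uxx"
    using G_heat_solution_flow[OF sl u(1)] .
  obtain vt vx vxx where fv: "G_heat_flow sl su v vt vx vxx"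
    using G_heat_solution_flow[OF sl v(1)] .
  interpret v: G_heat_flow sl su v vt vx vxx by (rule fv)
  have u0: "u x 0 = \<phi> x" and v0: "v x 0 = g x" for x
    using u(1) v(1) by (auto simp: G_heat_solution_def)
  have v0': "(\<lambda>x. v x 0) = g" using v0 by auto
  have "regular_G_heat_flow sl su v vt vx vxx (su\<^sup>2 / 2 * K)"
  proof (rule regular_G_heat_flow.intro[OF fv regular_G_heat_flow_axioms.intro])
    show "\<bar>v x 0 - v y 0\<bar> \<le> \<bar>x - y\<bar>" for x y
      using lipschitz_onD[OF g(2), of x y] by (simp add: v0 dist_real_def)
    show "\<bar>vt x t\<bar> \<le> su\<^sup>2 / 2 * K" if "0 < t" for t x
      by (rule v.ut_abs_le_of_smooth_initial[OF _ g(5,6) that]) (use g(4) v0' in simp)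
  qed
  then have "iid_G_heat_flow H E sl su v vt vx vxx (su\<^sup>2 / 2 * K) \<Theta> M5 X"
    by (intro iid_G_heat_flow.intro iid_G_heat_flow_axioms.intro sp mom iid law)
  from iid_G_heat_flow.convergence_rate[OF this \<open>0 < n\<close>]
  have "\<bar>E (\<lambda>w. g (normalized_sum X n w)) - N g\<bar> \<le> rate_const sl su * M5 / real n powr (1/4)"
    by (simp add: v0 v(2))
  moreover have "\<bar>N g - N \<phi>\<bar> \<le> e / 2"
    unfolding u(2) v(2) by (rule G_heat_flow_abs_diff_le[OF fv fu]) (unfold u0 v0, rule g(3), simp)
  moreover have "\<bar>E (\<lambda>w. \<phi> (normalized_sum X n w)) - E (\<lambda>w. g (normalized_sum X n w))\<bar> \<le> e / 2"
  proof -
    interpret sublinear_expectation_space H E by (rule sp)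
    note mem = CbLip_comp_mem[OF normalized_sum_mem[OF sp iid]]
    show ?thesis
      by (rule E_abs_diff_le[OF mem[OF \<phi>(1)] mem[OF g(1)]]) (subst abs_minus_commute, rule g(3))
  qed
  ultimately show "\<bar>E (\<lambda>w. \<phi> (normalized_sum X n w)) - N \<phi>\<bar>
      \<le> rate_const sl su * M5 / real n powr (1/4) + e" by linarith
qed

lemma CLT_rate_half:
  assumes sl: "0 < sl" "sl \<le> su"
  shows "0 < rate_const sl su" "CLT_rate TYPE('w) sl su (1/2) (rate_const sl su)"
proof -
  have "0 < doubling_const sl" using sl by (simp add: doubling_const_def add_pos_pos)
  then have "0 < ut_const sl su" using sl by (simp add: ut_const_def)
  then have "0 < ut_lip_const sl su" using \<open>0 < doubling_const sl\<close> by (simp add: ut_lip_const_def)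
  then have "0 \<le> time_const sl su" "0 \<le> uxx_hoelder_const sl su" "0 < layer_const sl su"
    using \<open>0 < ut_const sl su\<close> sl
    by (auto simp: time_const_def uxx_hoelder_const_def layer_const_def intro!: mult_nonneg_nonneg add_nonneg_nonneg add_pos_nonneg)
  then show C: "0 < rate_const sl su"
    unfolding rate_const_def using sl by (intro add_pos_nonneg divide_pos_pos) auto
  show "CLT_rate TYPE('w) sl su (1/2) (rate_const sl su)"
    unfolding CLT_rate_def
  proof (intro allI impI SUP_least)
    fix H :: "('w \<Rightarrow> real) set" and E X \<Theta> N and n :: nat and \<phi>
    assume sp: "sublinear_expectation_space H E" and iid: "iid_sequence H E X"
      and law: "represents_law E (X 1) \<Theta>"
      and e: "ext_expectation \<Theta> (\<lambda>x. x) = 0" "ext_expectation \<Theta> (\<lambda>x. - x) = 0"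
        "ext_expectation \<Theta> (\<lambda>x. x\<^sup>2) = ereal (su\<^sup>2)"
        "- ext_expectation \<Theta> (\<lambda>x. - (x\<^sup>2)) = ereal (sl\<^sup>2)"
      and N: "G_normal sl su N" and n: "1 \<le> n"
      and \<phi>: "\<phi> \<in> {\<phi> \<in> CbLip. 1-lipschitz_on UNIV \<phi>}"
    let ?M = "ext_expectation \<Theta> (\<lambda>x. \<bar>x\<bar> powr (2 + 1/2))"
    have ne: "\<Theta> \<noteq> {}" using law by (simp add: represents_law_def)
    then obtain M where "M \<in> \<Theta>" by blast
    have "0 \<le> ext_integral M (\<lambda>x. \<bar>x\<bar> powr (2 + 1/2))"
      by (simp add: ext_integral_def ennreal_neg zero_ennreal.rep_eq)
    also have "\<dots> \<le> ?M"
      unfolding ext_expectation_def using \<open>M \<in> \<Theta>\<close> by (rule SUP_upper)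
    finally have "0 \<le> ?M" .
    \<comment> \<open>An infinite moment makes the right-hand side infinite, since the constant is
      positive; nonnegativity of \<open>?M\<close> excludes the value
      \<open>-\<infinity>\<close>.\<close>
    then consider (inf) "?M = \<infinity>" | (real) M5 where "?M = ereal M5"
      by (cases ?M) auto
    then show "ereal \<bar>E (\<lambda>w. \<phi> (normalized_sum X n w)) - N \<phi>\<bar>
      \<le> ereal (rate_const sl su) * ?M / ereal (real n powr (1/2/2))"
    proof cases
      case inf
      then show ?thesis using C n by simp
    next
      case real
      have "moment_family \<Theta> sl su M5"
        by (rule moment_familyI[OF ne represents_law_real_distribution[OF law]])
          (use sl e real in auto)
      from rate_for_finite_moment[OF sl sp iid law this N, of n \<phi>] real n \<phi> show ?thesis by simp
    qed
  qed
qed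

text \<open>
  The constants are independent of the sample space because an i.i.d. sequence can be replaced by
  the coordinate sequence on its path space.
\<close>

lemma CLT_rate_transfer:
  assumes rate: "CLT_rate TYPE(nat \<Rightarrow> real) sl su \<alpha> C"
  shows "CLT_rate TYPE('w) sl su \<alpha> C"
  unfolding CLT_rate_def
proof (intro allI impI)
  fix H :: "('w \<Rightarrow> real) set" and E X \<Theta> N and n :: nat
  assume sp: "sublinear_expectation_space H E" and iid: "iid_sequence H E X"
    and law: "represents_law E (X 1) \<Theta>"
    and e: "ext_expectation \<Theta> (\<lambda>x. x) = 0" "ext_expectation \<Theta> (\<lambda>x. - x) = 0"
      "ext_expectation \<Theta> (\<lambda>x. x\<^sup>2) = ereal (su\<^sup>2)"
      "- ext_expectation \<Theta> (\<lambda>x. - (x\<^sup>2)) = ereal (sl\<^sup>2)"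
    and N: "G_normal sl su N" and n: "1 \<le> n"
  interpret sublinear_expectation_space H E by (rule sp)
  \<comment> \<open>\<open>E'\<close> is the image of \<open>E\<close> under the path map sending
    \<open>w\<close> to the sequence of the \<open>X i w\<close>. Composition with this map reduces
    every axiom to that of \<open>E\<close>; the same \<open>\<Theta>\<close> represents the law of
    the first coordinate, so all moments are unchanged.\<close>
  define H' where "H' = {f. (\<lambda>w. f (\<lambda>i. X i w)) \<in> H}"
  define E' where "E' = (\<lambda>f. E (\<lambda>w. f (\<lambda>i. X i w)))"
  define X' :: "nat \<Rightarrow> (nat \<Rightarrow> real) \<Rightarrow> real" where "X' = (\<lambda>i x. x i)"
  have sp': "sublinear_expectation_space H' E'"
  proof
    show "(\<lambda>w. \<psi> (\<lambda>i. Z i w)) \<in> H'" if "\<And>i. i < m \<Longrightarrow> Z i \<in> H'" "\<psi> \<in> CbLip_dim m" for m Z \<psi>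
      using comp_mem[of m "\<lambda>j w. Z j (\<lambda>i. X i w)" \<psi>] that by (simp add: H'_def)
    show "E' Y \<le> E' Z" if "Z \<in> H'" "Y \<in> H'" "\<And>w. Y w \<le> Z w" for Y Z
      using E_mono that by (simp add: H'_def E'_def)
    show "decseq (\<lambda>n. E' (\<lambda>w. \<phi> n (Z w))) \<and> (\<lambda>n. E' (\<lambda>w. \<phi> n (Z w))) \<longlonglongrightarrow> 0"
      if "Z \<in> H'" "\<And>n. \<phi> n \<in> CbLip" "\<And>x. decseq (\<lambda>n. \<phi> n x)" "\<And>x. (\<lambda>n. \<phi> n x) \<longlonglongrightarrow> 0" for Z \<phi>
      using E_cont[of "\<lambda>w. Z (\<lambda>i. X i w)" \<phi>] that by (simp add: H'_def E'_def)
    show "E' (\<lambda>w. c * Z w) = c * E' Z" if "Z \<in> H'" "0 \<le> c" for Z c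
      using E_scale that by (simp add: H'_def E'_def)
    show "E' (\<lambda>w. Y w + Z w) \<le> E' Y + E' Z" if "Y \<in> H'" "Z \<in> H'" for Y Z
      using E_subadd[of "\<lambda>w. Y (\<lambda>i. X i w)" "\<lambda>w. Z (\<lambda>i. X i w)"] that by (simp add: H'_def E'_def)
    show "(\<lambda>w. Y w + Z w) \<in> H'" if "Y \<in> H'" "Z \<in> H'" for Y Z
      using add_mem[of "\<lambda>w. Y (\<lambda>i. X i w)" "\<lambda>w. Z (\<lambda>i. X i w)"] that by (simp add: H'_def)
    show "(\<lambda>w. c * Z w) \<in> H'" if "Z \<in> H'" for Z c
      using scale_mem[of "\<lambda>w. Z (\<lambda>i. X i w)" c] that by (simp add: H'_def)
    show "(\<lambda>_. 0) \<in> H'" using zero_mem by (simp add: H'_def)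
    show "E' (\<lambda>_. c) = c" for c by (simp add: E'_def E_const)
  qed
  have iid': "iid_sequence H' E' X'"
    using iid
    unfolding iid_sequence_def identically_distributed_def independent_from_def H'_def E'_def X'_def
      mem_Collect_eq .
  have law': "represents_law E' (X' 1) \<Theta>"
    using law by (simp add: represents_law_def E'_def X'_def)
  have "(SUP \<phi>\<in>{\<phi> \<in> CbLip. 1-lipschitz_on UNIV \<phi>}.
        ereal \<bar>E' (\<lambda>w. \<phi> (normalized_sum X' n w)) - N \<phi>\<bar>)
      \<le> ereal C * ext_expectation \<Theta> (\<lambda>x. \<bar>x\<bar> powr (2 + \<alpha>)) / ereal (real n powr (\<alpha> / 2))"
    using rate sp' iid' law' e N n unfolding CLT_rate_def by blast
  then show "(SUP \<phi>\<in>{\<phi> \<in> CbLip. 1-lipschitz_on UNIV \<phi>}.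
        ereal \<bar>E (\<lambda>w. \<phi> (normalized_sum X n w)) - N \<phi>\<bar>)
      \<le> ereal C * ext_expectation \<Theta> (\<lambda>x. \<bar>x\<bar> powr (2 + \<alpha>)) / ereal (real n powr (\<alpha> / 2))"
    by (simp add: E'_def X'_def normalized_sum_def)
qed

theorem theorem4p5:
  fixes sl su :: real
  assumes "0 < sl" and "sl \<le> su"
  shows "(\<exists>\<alpha> C. 0 < \<alpha> \<and> \<alpha> < 1 \<and> 0 < C \<and> CLT_rate TYPE(nat \<Rightarrow> real) sl su \<alpha> C) \<and>
         (\<forall>\<alpha> C. 0 < \<alpha> \<and> \<alpha> < 1 \<and> 0 < C \<and> CLT_rate TYPE(nat \<Rightarrow> real) sl su \<alpha> C \<longrightarrow>
                CLT_rate TYPE('w) sl su \<alpha> C)"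
proof (intro conjI)
  show "\<exists>\<alpha> C. 0 < \<alpha> \<and> \<alpha> < 1 \<and> 0 < C \<and> CLT_rate TYPE(nat \<Rightarrow> real) sl su \<alpha> C"
    using CLT_rate_half[OF assms] by (intro exI[of _ "1/2"] exI[of _ "rate_const sl su"]) auto
qed (use CLT_rate_transfer in blast)

end
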